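(* For all integers $k,l\ge 0$ the vector fields $Y_k$ and $Y_l$ on the space $\mathcal{M}$ of curves in $\mathbb{R}^3$ with monodromy commute, i.e. $[Y_k,Y_l]_{\mathcal{M}}=0$; explicitly, for every $\gamma\in\mathcal{M}$ the derivative of $Y_k$ at $\gamma$ in the direction $Y_l(\gamma)$ equals the derivative of $Y_l$ at $\gamma$ in the direction $Y_k(\gamma)$.
   Context: Let $M\cong\mathbb{R}$ be an oriented 1-manifold with a fixed translation $\tau\in\mathrm{Diff}(M)$, $M/\tau\cong S^1$. Let $h(p)=Ap+a$ ($A\in SO(3)$, $a\in\mathbb{R}^3$) be an orientation preserving Euclidean motion, and let $\mathcal{M}=\mathcal{M}_h$ be the Fréchet manifold of smooth immersions $\gamma\colon M\to\mathbb{R}^3$ with $\gamma\circ\tau=h\circ\gamma$. Its tangent space $T_\gamma\mathcal{M}$ consists of smooth maps $\xi\colon M\to\mathbb{R}^3$ with $\xi\circ\tau=A\xi$. For $\gamma\in\mathcal{M}$ let $dx$ be the arclength 1-form of $\gamma$ (it depends on $\gamma$), let $(\ )'$ denote the derivative with respect to arclength, and $T=\gamma'$ the unit tangent. $(\cdot,\cdot)$ and $\times$ are the Euclidean inner product and cross product. The vector fields $Y_k\in\Gamma(T\mathcal{M})$, $k\ge 0$, are defined by $Y_0=T$ and $$Y_{k+1}=T\times Y_k'-\tfrac12\sum_{i=1}^{k}(Y_i,Y_{k-i+1})\,T,\qquad k\ge 0.$$ They satisfy the recursion $Y_k'+T\times Y_{k+1}=0$. *)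

theory Defs
  imports "HOL-Analysis.Analysis"
begin

definition nth_derivative :: "nat \<Rightarrow> (real \<Rightarrow> 'a::real_normed_vector) \<Rightarrow> real \<Rightarrow> 'a" where
  "nth_derivative n f = ((\<lambda>g s. vector_derivative g (at s)) ^^ n) f"

definition smooth :: "(real \<Rightarrow> 'a::real_normed_vector) \<Rightarrow> bool" where
  "smooth f \<longleftrightarrow> (\<forall>n s. nth_derivative n f differentiable at s)"

text \<open>The oriented 1-manifold is the real line with its standard orientation. A
  diffeomorphism \<open>\<tau>\<close> of it is a translation if the quotient by the group
  generated by \<open>\<tau>\<close> is a circle, i.e. if there is a smooth immersion \<open>\<pi>\<close> onto the unit circle
  (of equal dimension, hence a local diffeomorphism) whose fibres are exactly the
  \<open>\<tau>\<close>-orbits.\<close>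

definition diffeomorphism :: "(real \<Rightarrow> real) \<Rightarrow> bool" where
  "diffeomorphism \<tau> \<longleftrightarrow> bij \<tau> \<and> smooth \<tau> \<and> smooth (inv \<tau>)"

definition translation :: "(real \<Rightarrow> real) \<Rightarrow> bool" where
  "translation \<tau> \<longleftrightarrow> diffeomorphism \<tau> \<and>
    (\<exists>\<pi> :: real \<Rightarrow> complex. smooth \<pi> \<and> range \<pi> = sphere 0 1 \<and>
      (\<forall>s. vector_derivative \<pi> (at s) \<noteq> 0) \<and>
      (\<forall>s t. \<pi> s = \<pi> t \<longleftrightarrow> (\<exists>n. t = (\<tau> ^^ n) s \<or> s = (\<tau> ^^ n) t)))"

text \<open>Immersions with monodromy \<open>p \<mapsto> A p + a\<close>, and the tangent space, which is
  the same at every curve.\<close>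

definition curves :: "(real \<Rightarrow> real) \<Rightarrow> real^3^3 \<Rightarrow> real^3 \<Rightarrow> (real \<Rightarrow> real^3) set" where
  "curves \<tau> A a = {\<gamma>. smooth \<gamma> \<and> (\<forall>s. vector_derivative \<gamma> (at s) \<noteq> 0) \<and>
    (\<forall>s. \<gamma> (\<tau> s) = A *v \<gamma> s + a)}"

definition tangent_space :: "(real \<Rightarrow> real) \<Rightarrow> real^3^3 \<Rightarrow> (real \<Rightarrow> real^3) set" where
  "tangent_space \<tau> A = {\<xi>. smooth \<xi> \<and> (\<forall>s. \<xi> (\<tau> s) = A *v \<xi> s)}"

definition arclength_derivative ::
    "(real \<Rightarrow> real^3) \<Rightarrow> (real \<Rightarrow> 'a::real_normed_vector) \<Rightarrow> real \<Rightarrow> 'a" where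
  "arclength_derivative \<gamma> f s =
    vector_derivative f (at s) /\<^sub>R norm (vector_derivative \<gamma> (at s))"

definition unit_tangent :: "(real \<Rightarrow> real^3) \<Rightarrow> real \<Rightarrow> real^3" where
  "unit_tangent \<gamma> = arclength_derivative \<gamma> \<gamma>"

fun Y :: "nat \<Rightarrow> (real \<Rightarrow> real^3) \<Rightarrow> real \<Rightarrow> real^3" where
  "Y 0 \<gamma> = unit_tangent \<gamma>"
| "Y (Suc k) \<gamma> = (\<lambda>s. cross3 (unit_tangent \<gamma> s) (arclength_derivative \<gamma> (Y k \<gamma>) s) -
    ((1/2) * (\<Sum>i = 1..k. Y i \<gamma> s \<bullet> Y (k - i + 1) \<gamma> s)) *\<^sub>R unit_tangent \<gamma> s)"

text \<open>Derivative of a vector field \<open>V\<close> at \<open>\<gamma>\<close> in direction \<open>\<xi>\<close>: the limit \<open>Z\<close> of difference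
  quotients along the affine line \<open>\<gamma> + t \<xi>\<close>, in the Frechet topology of the tangent space
  (uniform convergence of all derivatives on compact sets). For small \<open>t\<close> this line stays in the space of
  curves, since \<open>(\<gamma> + t \<xi>) \<circ> \<tau> = A (\<gamma> + t \<xi>) + a\<close> and the quotient by \<open>\<tau>\<close> is compact.\<close>

definition has_directional_derivative ::
    "(real \<Rightarrow> real) \<Rightarrow> real^3^3 \<Rightarrow> ((real \<Rightarrow> real^3) \<Rightarrow> real \<Rightarrow> real^3) \<Rightarrow>
      (real \<Rightarrow> real^3) \<Rightarrow> (real \<Rightarrow> real^3) \<Rightarrow> (real \<Rightarrow> real^3) \<Rightarrow> bool" where
  "has_directional_derivative \<tau> A V \<gamma> \<xi> Z \<longleftrightarrow> Z \<in> tangent_space \<tau> A \<and>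
    (\<forall>n K. compact K \<longrightarrow> uniform_limit K
      (\<lambda>t. nth_derivative n (\<lambda>s. (V (\<lambda>u. \<gamma> u + t *\<^sub>R \<xi> u) s - V \<gamma> s) /\<^sub>R t))
      (nth_derivative n Z) (at 0))"

definition has_lie_bracket ::
    "(real \<Rightarrow> real) \<Rightarrow> real^3^3 \<Rightarrow> ((real \<Rightarrow> real^3) \<Rightarrow> real \<Rightarrow> real^3) \<Rightarrow>
      ((real \<Rightarrow> real^3) \<Rightarrow> real \<Rightarrow> real^3) \<Rightarrow> (real \<Rightarrow> real^3) \<Rightarrow> (real \<Rightarrow> real^3) \<Rightarrow> bool" where
  "has_lie_bracket \<tau> A V W \<gamma> Z \<longleftrightarrow>
    (\<exists>U1 U2. has_directional_derivative \<tau> A W \<gamma> (V \<gamma>) U1 \<and>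
      has_directional_derivative \<tau> A V \<gamma> (W \<gamma>) U2 \<and> Z = (\<lambda>s. U1 s - U2 s))"

end

theory Submission
  imports Defs
begin

text \<open>
Collect the vector fields in the formal series \<open>Y = \<Sum>\<^sub>k Y\<^sub>k x\<^sup>k\<close>. Two identities characterise the
hierarchy: \<open>Y \<bullet> Y = 1\<close> (lemma \<open>sum_inner_Y_Suc\<close>) and \<open>x Y' + T \<times> Y = 0\<close> (lemma \<open>Y_recursion\<close>);
from the second, \<open>T \<bullet> Y\<^sub>l' = 0\<close>, that is, a deformation of a curve in the direction \<open>Y\<^sub>l\<close> preserves
arclength. Its variation \<open>\<delta>\<^sub>l\<close> therefore commutes with the arclength derivative, and
\<open>\<delta>\<^sub>l T = Y\<^sub>l' = Y\<^sub>l\<^sub>+\<^sub>1 \<times> T\<close>. This starts an equation of Lax type,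
\<open>\<delta>\<^sub>l Y = P\<^sub>l \<times> Y\<close> with \<open>P\<^sub>l = \<Sum>\<^sub>m Y\<^sub>l\<^sub>+\<^sub>1\<^sub>+\<^sub>m x\<^sup>m\<close>: its right-hand side satisfies the linearisations
of both identities (lemmas \<open>bracket_sum_inner\<close> and \<open>bracket_sum_derivative\<close>), and these determine
\<open>\<delta>\<^sub>l Y\<close> from \<open>\<delta>\<^sub>l T\<close>. The coefficient of \<open>x\<^sup>k\<close> is
\<open>\<delta>\<^sub>l Y\<^sub>k = \<Sum> Y\<^sub>i \<times> Y\<^sub>j\<close>, summed over \<open>i + j = k + l + 1\<close> and \<open>i > l\<close>, and by antisymmetry of the cross
product it does not change when \<open>k\<close> and \<open>l\<close> are exchanged (lemma \<open>bracket_sum_commute\<close>).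

The analytic task is to show that the difference quotients defining \<open>\<delta>\<^sub>l Y\<^sub>k\<close> converge locally uniformly
with all derivatives. Families of functions whose difference quotients converge in this sense are closed
under differentiation, under bilinear operations and under \<open>V \<mapsto> 1 / \<bar>V\<bar>\<close> for nowhere vanishing \<open>V\<close>;
these are the only operations in the definition of \<open>Y\<^sub>k\<close>, and the limits obey the usual rules of calculus
(lemma \<open>smooth_variation_Y_Suc\<close>).

Finally \<open>\<delta>\<^sub>l Y\<^sub>k\<close> is a tangent vector because each \<open>Y\<^sub>i\<close> is equivariant under the monodromy, which
involves that a translation of the line preserves its orientation (lemma \<open>translation_deriv_pos\<close>).
\<close>

section \<open>Variations of one-parameter families of functions\<close>

abbreviation deriv_fun :: "(real \<Rightarrow> 'a::real_normed_vector) \<Rightarrow> real \<Rightarrow> 'a" where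
  "deriv_fun f \<equiv> (\<lambda>s. vector_derivative f (at s))"

text \<open>A family of functions is written \<open>F t s\<close>, with parameter \<open>t\<close> and variable \<open>s\<close>, and is
varied at \<open>t = 0\<close>. The limit of the difference quotient is taken jointly in \<open>t \<rightarrow> 0\<close> and
\<open>u \<rightarrow> s\<close>: for a continuous limit this is locally uniform convergence, but it can be handled by
the rules for ordinary limits.\<close>

definition first_variation ::
    "(real \<Rightarrow> real \<Rightarrow> 'a::real_normed_vector) \<Rightarrow> (real \<Rightarrow> 'a) \<Rightarrow> bool" where
  "first_variation F Z \<longleftrightarrow> (\<forall>s. isCont (F 0) s \<and>
    ((\<lambda>p. (F (fst p) (snd p) - F 0 (snd p)) /\<^sub>R fst p) \<longlongrightarrow> Z s) (at 0 \<times>\<^sub>F nhds s))"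

text \<open>Convergence of the difference quotients together with their first \<open>n\<close> derivatives in \<open>s\<close>. The
recursion says that the variation of the derivative is the derivative of the variation. Regularity of
\<open>F t\<close> is required only near \<open>t = 0\<close>, with a bound on \<open>t\<close> that may depend on the point: on the
whole line no uniform bound is available, and a deformed curve may fail to be immersed far away.\<close>

primrec variation_upto ::
    "nat \<Rightarrow> (real \<Rightarrow> real \<Rightarrow> 'a::real_normed_vector) \<Rightarrow> (real \<Rightarrow> 'a) \<Rightarrow> bool" where
  "variation_upto 0 F Z = first_variation F Z"
| "variation_upto (Suc n) F Z = (first_variation F Z \<and>
    (\<forall>s. Z differentiable at s \<and>
      (\<forall>\<^sub>F p in nhds (0, s). F (fst p) differentiable at (snd p))) \<and>
    variation_upto n (\<lambda>t. deriv_fun (F t)) (deriv_fun Z))"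

definition smooth_variation ::
    "(real \<Rightarrow> real \<Rightarrow> 'a::real_normed_vector) \<Rightarrow> (real \<Rightarrow> 'a) \<Rightarrow> bool" where
  "smooth_variation F Z \<longleftrightarrow> (\<forall>n. variation_upto n F Z)"

text \<open>Agreement for parameters near \<open>0\<close>, locally in the variable: the formulas for derivatives of
\<open>F t\<close> hold only where \<open>F t\<close> is regular, and variations depend on no more than this.\<close>

definition locally_equal ::
    "(real \<Rightarrow> real \<Rightarrow> 'a) \<Rightarrow> (real \<Rightarrow> real \<Rightarrow> 'a) \<Rightarrow> bool" where
  "locally_equal F G \<longleftrightarrow> (\<forall>s. \<forall>\<^sub>F p in nhds (0, s). F (fst p) (snd p) = G (fst p) (snd p))"

lemma at_nhds_le_nhds: "at (0::real) \<times>\<^sub>F nhds (s::real) \<le> nhds (0, s)"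
  unfolding nhds_prod by (intro prod_filter_mono) (simp_all add: at_within_def)

lemma eventually_fst_nonzero: "\<forall>\<^sub>F p in at (0::real) \<times>\<^sub>F nhds (s::real). fst p \<noteq> 0"
proof -
  have "filterlim fst (at 0) (at (0::real) \<times>\<^sub>F nhds s)"
    by (rule filterlim_fst)
  moreover have "\<forall>\<^sub>F t in at (0::real). t \<noteq> 0"
    by (simp add: eventually_at_filter)
  ultimately show ?thesis unfolding filterlim_iff by fast
qed

lemma eventually_slice:
  assumes "\<forall>\<^sub>F q in nhds (p :: real \<times> real). P q"
  shows "\<forall>\<^sub>F u in nhds (snd p). P (fst p, u)"
proof -
  have "((\<lambda>u. (fst p, u)) \<longlongrightarrow> (fst p, snd p)) (nhds (snd p))"
    by (intro tendsto_intros) (simp add: filterlim_ident)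
  then show ?thesis using assms by (auto simp: filterlim_iff)
qed

lemma locally_equal_at_0:
  assumes "locally_equal F G"
  shows "F 0 = G 0"
proof
  fix s
  have "\<forall>\<^sub>F p in nhds (0, s). F (fst p) (snd p) = G (fst p) (snd p)"
    using assms by (simp add: locally_equal_def)
  from eventually_nhds_x_imp_x[OF this] show "F 0 s = G 0 s" by simp
qed

lemma deriv_fun_cong:
  assumes "\<forall>\<^sub>F u in nhds s. f u = g u"
  shows "deriv_fun f s = deriv_fun g s"
  using assms by (intro vector_derivative_cong_eq) (auto elim: eventually_mono)

lemma differentiable_cong:
  assumes "\<forall>\<^sub>F u in nhds (s::real). f u = g u" "f differentiable at s"
  shows "g differentiable at s"
proof -
  have "(f has_vector_derivative vector_derivative f (at s)) (at s)"
    using assms(2) vector_derivative_works by blast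
  then have "(g has_vector_derivative vector_derivative f (at s)) (at s)"
    using has_vector_derivative_cong_ev[where S = UNIV and f = f and g = g and x = s] assms(1)
    by (auto elim: eventually_mono dest: eventually_nhds_x_imp_x)
  then show ?thesis by (rule differentiableI_vector)
qed

lemma locally_equal_deriv:
  assumes "locally_equal F G"
  shows "locally_equal (\<lambda>t. deriv_fun (F t)) (\<lambda>t. deriv_fun (G t))"
  unfolding locally_equal_def
proof
  fix s
  have "\<forall>\<^sub>F p in nhds (0, s). \<forall>\<^sub>F q in nhds p. F (fst q) (snd q) = G (fst q) (snd q)"
    using assms by (simp add: locally_equal_def eventually_eventually)
  then show "\<forall>\<^sub>F p in nhds (0, s). deriv_fun (F (fst p)) (snd p) = deriv_fun (G (fst p)) (snd p)"
    by eventually_elim (rule deriv_fun_cong, drule eventually_slice, simp)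
qed

lemma first_variation_cong:
  assumes "first_variation F Z" "locally_equal F G"
  shows "first_variation G Z"
  unfolding first_variation_def
proof (intro allI conjI)
  fix s
  have FG: "F 0 = G 0" using assms(2) by (rule locally_equal_at_0)
  then show "isCont (G 0) s" using assms(1) by (simp add: first_variation_def)
  have "\<forall>\<^sub>F p in at 0 \<times>\<^sub>F nhds s. (F (fst p) (snd p) - F 0 (snd p)) /\<^sub>R fst p
      = (G (fst p) (snd p) - G 0 (snd p)) /\<^sub>R fst p"
    using filter_leD[OF at_nhds_le_nhds assms(2)[unfolded locally_equal_def, rule_format, of s]]
    by (rule eventually_mono) (simp add: FG)
  then show "((\<lambda>p. (G (fst p) (snd p) - G 0 (snd p)) /\<^sub>R fst p) \<longlongrightarrow> Z s) (at 0 \<times>\<^sub>F nhds s)"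
    using assms(1)[unfolded first_variation_def] by (blast intro: Lim_transform_eventually)
qed

lemma variation_upto_cong:
  assumes "variation_upto n F Z" "locally_equal F G"
  shows "variation_upto n G Z"
  using assms
proof (induction n arbitrary: F G Z)
  case 0
  then show ?case using first_variation_cong by auto
next
  case (Suc n)
  have "\<forall>\<^sub>F p in nhds (0, s). G (fst p) differentiable at (snd p)" for s
  proof -
    have "\<forall>\<^sub>F p in nhds (0, s). \<forall>\<^sub>F q in nhds p. F (fst q) (snd q) = G (fst q) (snd q)"
      using Suc.prems(2) by (simp add: locally_equal_def eventually_eventually)
    moreover have "\<forall>\<^sub>F p in nhds (0, s). F (fst p) differentiable at (snd p)"
      using Suc.prems(1) by simp
    ultimately show ?thesis
    proof eventually_elim
      case (elim p)
      from eventually_slice[OF elim(1)] elim(2) show ?case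
        by (auto intro: differentiable_cong)
    qed
  qed
  then show ?case
    using Suc.prems first_variation_cong Suc.IH[OF _ locally_equal_deriv] by auto
qed

lemma variation_upto_first: "variation_upto n F Z \<Longrightarrow> first_variation F Z"
  by (cases n) auto

lemma variation_upto_SucD: "variation_upto (Suc n) F Z \<Longrightarrow> variation_upto n F Z"
proof (induction n arbitrary: F Z)
  case (Suc n)
  from Suc.prems have "variation_upto n (\<lambda>t. deriv_fun (F t)) (deriv_fun Z)"
    by (intro Suc.IH) simp
  with Suc.prems show ?case by simp
qed simp

lemma first_variation_base_tendsto:
  assumes "first_variation F Z"
  shows "((\<lambda>p. F 0 (snd p)) \<longlongrightarrow> F 0 s) (at 0 \<times>\<^sub>F nhds s)"
proof -
  have "(F 0 \<longlongrightarrow> F 0 s) (nhds s)"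
    using assms by (auto simp: first_variation_def isCont_def tendsto_at_iff_tendsto_nhds)
  moreover have "filterlim snd (nhds s) (at 0 \<times>\<^sub>F nhds s)"
    by (rule filterlim_snd)
  ultimately show ?thesis by (rule filterlim_compose)
qed

lemma first_variation_tendsto:
  assumes "first_variation F Z"
  shows "((\<lambda>p. F (fst p) (snd p)) \<longlongrightarrow> F 0 s) (at 0 \<times>\<^sub>F nhds s)"
proof -
  have "filterlim fst (at 0) (at (0::real) \<times>\<^sub>F nhds s)"
    by (rule filterlim_fst)
  then have t: "(fst \<longlongrightarrow> (0::real)) (at 0 \<times>\<^sub>F nhds s)"
    by (simp add: filterlim_at)
  have "((\<lambda>p. F 0 (snd p) + fst p *\<^sub>R ((F (fst p) (snd p) - F 0 (snd p)) /\<^sub>R fst p))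
      \<longlongrightarrow> F 0 s + 0 *\<^sub>R Z s) (at 0 \<times>\<^sub>F nhds s)"
    using assms
    by (intro tendsto_intros first_variation_base_tendsto[OF assms] t)
       (simp add: first_variation_def)
  then have "((\<lambda>p. F 0 (snd p) + fst p *\<^sub>R ((F (fst p) (snd p) - F 0 (snd p)) /\<^sub>R fst p))
      \<longlongrightarrow> F 0 s) (at 0 \<times>\<^sub>F nhds s)" by simp
  then show ?thesis
    by (rule Lim_transform_eventually)
       (use eventually_fst_nonzero[of s] in \<open>auto elim!: eventually_mono\<close>)
qed

text \<open>The Leibniz rule: for every \<open>t\<close>,
\<open>B (F t) (G t) - B (F 0) (G 0) = B (F t - F 0) (G t) + B (F 0) (G t - G 0)\<close>.\<close>

lemma first_variation_bilinear:
  fixes F :: "real \<Rightarrow> real \<Rightarrow> 'a::real_normed_vector" and G :: "real \<Rightarrow> real \<Rightarrow> 'b::real_normed_vector"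
    and B :: "'a \<Rightarrow> 'b \<Rightarrow> 'c::real_normed_vector"
  assumes B: "bounded_bilinear B" and F: "first_variation F Z" and G: "first_variation G W"
  shows "first_variation (\<lambda>t s. B (F t s) (G t s)) (\<lambda>s. B (Z s) (G 0 s) + B (F 0 s) (W s))"
proof -
  interpret bounded_bilinear B by (rule B)
  show ?thesis
    unfolding first_variation_def
  proof (intro allI conjI)
    fix s
    show "isCont (\<lambda>s. B (F 0 s) (G 0 s)) s"
      using F G by (auto simp: first_variation_def intro: isCont)
    have "((\<lambda>p. B ((F (fst p) (snd p) - F 0 (snd p)) /\<^sub>R fst p) (G (fst p) (snd p))
        + B (F 0 (snd p)) ((G (fst p) (snd p) - G 0 (snd p)) /\<^sub>R fst p))
        \<longlongrightarrow> B (Z s) (G 0 s) + B (F 0 s) (W s)) (at 0 \<times>\<^sub>F nhds s)"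
      using F G
      by (intro tendsto_add tendsto first_variation_base_tendsto[OF F] first_variation_tendsto[OF G])
        (simp_all add: first_variation_def)
    then show "((\<lambda>p. (B (F (fst p) (snd p)) (G (fst p) (snd p)) - B (F 0 (snd p)) (G 0 (snd p))) /\<^sub>R fst p)
        \<longlongrightarrow> B (Z s) (G 0 s) + B (F 0 s) (W s)) (at 0 \<times>\<^sub>F nhds s)"
      by (simp add: scaleR_left scaleR_right diff_left diff_right algebra_simps)
  qed
qed

lemma first_variation_add:
  assumes "first_variation F Z" "first_variation G W"
  shows "first_variation (\<lambda>t s. F t s + G t s) (\<lambda>s. Z s + W s)"
  unfolding first_variation_def
proof (intro allI conjI)
  fix s
  show "isCont (\<lambda>s. F 0 s + G 0 s) s"
    using assms by (auto simp: first_variation_def)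
  have "((\<lambda>p. (F (fst p) (snd p) - F 0 (snd p)) /\<^sub>R fst p
      + (G (fst p) (snd p) - G 0 (snd p)) /\<^sub>R fst p) \<longlongrightarrow> Z s + W s) (at 0 \<times>\<^sub>F nhds s)"
    using assms by (intro tendsto_add) (auto simp: first_variation_def)
  then show "((\<lambda>p. (F (fst p) (snd p) + G (fst p) (snd p) - (F 0 (snd p) + G 0 (snd p))) /\<^sub>R fst p)
      \<longlongrightarrow> Z s + W s) (at 0 \<times>\<^sub>F nhds s)"
    by (simp add: algebra_simps)
qed

lemma variation_upto_Suc_differentiable:
  assumes "variation_upto (Suc n) F Z"
  shows "F 0 differentiable at s" "Z differentiable at s"
proof -
  have "\<forall>\<^sub>F p in nhds (0, s). F (fst p) differentiable at (snd p)"
    using assms by simp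
  from eventually_nhds_x_imp_x[OF this] show "F 0 differentiable at s" by simp
  show "Z differentiable at s" using assms by simp
qed

lemma variation_upto_add:
  assumes "variation_upto n F Z" "variation_upto n G W"
  shows "variation_upto n (\<lambda>t s. F t s + G t s) (\<lambda>s. Z s + W s)"
  using assms
proof (induction n arbitrary: F G Z W)
  case 0
  then show ?case using first_variation_add by auto
next
  case (Suc n)
  have diff: "\<forall>\<^sub>F p in nhds (0, s). F (fst p) differentiable at (snd p) \<and> G (fst p) differentiable at (snd p)" for s
    using Suc.prems by (auto intro: eventually_conj)
  have "variation_upto n (\<lambda>t s. deriv_fun (F t) s + deriv_fun (G t) s)
      (\<lambda>s. deriv_fun Z s + deriv_fun W s)"
    using Suc by auto
  moreover have "locally_equal (\<lambda>t s. deriv_fun (F t) s + deriv_fun (G t) s)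
      (\<lambda>t. deriv_fun (\<lambda>s. F t s + G t s))"
    unfolding locally_equal_def by (intro allI eventually_mono[OF diff]) simp
  ultimately have "variation_upto n (\<lambda>t. deriv_fun (\<lambda>s. F t s + G t s))
      (\<lambda>s. deriv_fun Z s + deriv_fun W s)"
    by (rule variation_upto_cong)
  moreover have "deriv_fun (\<lambda>s. Z s + W s) = (\<lambda>s. deriv_fun Z s + deriv_fun W s)"
    using Suc.prems by (intro ext vector_derivative_add_at) auto
  ultimately show ?case
    using Suc.prems first_variation_add[of F Z G W] eventually_mono[OF diff] by simp
qed

lemma has_vector_derivative_bilinear:
  assumes "bounded_bilinear B" "f differentiable at s" "g differentiable at s"
  shows "((\<lambda>s. B (f s) (g s)) has_vector_derivative
    B (deriv_fun f s) (g s) + B (f s) (deriv_fun g s)) (at s)"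
  using bounded_bilinear.has_vector_derivative[OF assms(1)
      assms(2)[unfolded vector_derivative_works] assms(3)[unfolded vector_derivative_works]]
  by (simp add: add.commute)

text \<open>The derivative of a product is a sum of products of the same kind with one factor differentiated, so
the Leibniz rule of order zero climbs to every order by induction.\<close>

lemma variation_upto_bilinear:
  fixes F :: "real \<Rightarrow> real \<Rightarrow> 'a::real_normed_vector" and G :: "real \<Rightarrow> real \<Rightarrow> 'b::real_normed_vector"
    and B :: "'a \<Rightarrow> 'b \<Rightarrow> 'c::real_normed_vector"
  assumes B: "bounded_bilinear B"
  assumes "variation_upto n F Z" "variation_upto n G W"
  shows "variation_upto n (\<lambda>t s. B (F t s) (G t s)) (\<lambda>s. B (Z s) (G 0 s) + B (F 0 s) (W s))"
  using assms(2,3)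
proof (induction n arbitrary: F G Z W)
  case 0
  then show ?case using first_variation_bilinear[OF B] by auto
next
  case (Suc n)
  note deriv = has_vector_derivative_bilinear[OF B]
  have diff: "\<forall>\<^sub>F p in nhds (0, s). F (fst p) differentiable at (snd p) \<and> G (fst p) differentiable at (snd p)" for s
    using Suc.prems by (auto intro: eventually_conj)
  have diff0: "F 0 differentiable at s" "Z differentiable at s" "G 0 differentiable at s"
      "W differentiable at s" for s
    using variation_upto_Suc_differentiable[OF Suc.prems(1)]
      variation_upto_Suc_differentiable[OF Suc.prems(2)] by simp_all
  have "variation_upto n (\<lambda>t s. B (deriv_fun (F t) s) (G t s) + B (F t s) (deriv_fun (G t) s))
      (\<lambda>s. (B (deriv_fun Z s) (G 0 s) + B (deriv_fun (F 0) s) (W s))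
        + (B (Z s) (deriv_fun (G 0) s) + B (F 0 s) (deriv_fun W s)))"
    using Suc.prems variation_upto_SucD[OF Suc.prems(1)] variation_upto_SucD[OF Suc.prems(2)]
    by (intro variation_upto_add Suc.IH) auto
  moreover have "locally_equal (\<lambda>t s. B (deriv_fun (F t) s) (G t s) + B (F t s) (deriv_fun (G t) s))
      (\<lambda>t. deriv_fun (\<lambda>s. B (F t s) (G t s)))"
    unfolding locally_equal_def
    by (intro allI eventually_mono[OF diff]) (simp add: vector_derivative_at[OF deriv])
  ultimately have "variation_upto n (\<lambda>t. deriv_fun (\<lambda>s. B (F t s) (G t s)))
      (\<lambda>s. (B (deriv_fun Z s) (G 0 s) + B (deriv_fun (F 0) s) (W s))
        + (B (Z s) (deriv_fun (G 0) s) + B (F 0 s) (deriv_fun W s)))"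
    by (rule variation_upto_cong)
  moreover have lim: "((\<lambda>s. B (Z s) (G 0 s) + B (F 0 s) (W s)) has_vector_derivative
      (B (deriv_fun Z s) (G 0 s) + B (deriv_fun (F 0) s) (W s))
        + (B (Z s) (deriv_fun (G 0) s) + B (F 0 s) (deriv_fun W s))) (at s)" for s
    using has_vector_derivative_add[OF deriv[of Z s "G 0"] deriv[of "F 0" s W]] diff0
    by (simp add: algebra_simps)
  ultimately have "variation_upto n (\<lambda>t. deriv_fun (\<lambda>s. B (F t s) (G t s)))
      (deriv_fun (\<lambda>s. B (Z s) (G 0 s) + B (F 0 s) (W s)))"
    by (simp add: vector_derivative_at[OF lim])
  moreover have "\<forall>\<^sub>F p in nhds (0, s). (\<lambda>u. B (F (fst p) u) (G (fst p) u)) differentiable at (snd p)" for s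
    using diff[of s] by (rule eventually_mono) (use deriv in \<open>blast intro: differentiableI_vector\<close>)
  moreover have "(\<lambda>s. B (Z s) (G 0 s) + B (F 0 s) (W s)) differentiable at s" for s
    using lim by (rule differentiableI_vector)
  ultimately show ?case
    using first_variation_bilinear[OF B variation_upto_first[OF Suc.prems(1)]
        variation_upto_first[OF Suc.prems(2)]] by simp
qed

lemma nth_derivative_0: "nth_derivative 0 f = f"
  by (simp add: nth_derivative_def)

lemma nth_derivative_Suc: "nth_derivative (Suc n) f = nth_derivative n (deriv_fun f)"
  by (simp add: nth_derivative_def funpow_Suc_right del: funpow.simps)

lemma smooth_differentiable: "smooth f \<Longrightarrow> f differentiable at s"
  using nth_derivative_0[of f] unfolding smooth_def by (elim allE[of _ 0] allE[of _ s]) simp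

lemma smooth_deriv_fun: "smooth f \<Longrightarrow> smooth (deriv_fun f)"
  unfolding smooth_def nth_derivative_Suc[symmetric] by blast

lemma smooth_continuous: "smooth f \<Longrightarrow> isCont f s"
  using differentiable_imp_continuous_within[of f s UNIV] smooth_differentiable[of f s] by simp

lemma smooth_const: "smooth (\<lambda>s. c)"
proof -
  have "nth_derivative n (\<lambda>s. c) differentiable at s" for n s
    by (induction n arbitrary: c) (simp_all add: nth_derivative_0 nth_derivative_Suc)
  then show ?thesis by (simp add: smooth_def)
qed

text \<open>The deformations of a curve along straight lines, which define directional derivatives.\<close>

lemma variation_upto_affine:
  assumes "smooth f" "smooth \<xi>"
  shows "variation_upto n (\<lambda>t s. f s + t *\<^sub>R \<xi> s) \<xi>"
  using assms
proof (induction n arbitrary: f \<xi>)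
  case 0
  have "((\<lambda>p. ((f (snd p) + fst p *\<^sub>R \<xi> (snd p)) - f (snd p)) /\<^sub>R fst p) \<longlongrightarrow> \<xi> s)
      (at 0 \<times>\<^sub>F nhds s)" for s
  proof (rule Lim_transform_eventually)
    have "(\<xi> \<longlongrightarrow> \<xi> s) (nhds s)"
      using smooth_continuous[OF 0(2)] by (auto simp: isCont_def tendsto_at_iff_tendsto_nhds)
    then show "((\<lambda>p. \<xi> (snd p)) \<longlongrightarrow> \<xi> s) (at 0 \<times>\<^sub>F nhds s)"
      by (rule filterlim_compose) (rule filterlim_snd)
    show "\<forall>\<^sub>F p in at 0 \<times>\<^sub>F nhds s. \<xi> (snd p) = ((f (snd p) + fst p *\<^sub>R \<xi> (snd p)) - f (snd p)) /\<^sub>R fst p"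
      by (rule eventually_mono[OF eventually_fst_nonzero]) simp
  qed
  then show ?case
    using smooth_continuous[OF 0(1)] by (simp add: first_variation_def)
next
  case (Suc n)
  have deriv: "((\<lambda>s. f s + t *\<^sub>R \<xi> s) has_vector_derivative deriv_fun f s + t *\<^sub>R deriv_fun \<xi> s) (at s)"
    for t s
    using smooth_differentiable[OF Suc.prems(1)] smooth_differentiable[OF Suc.prems(2)]
    by (auto simp: vector_derivative_works intro!: derivative_eq_intros)
  have "variation_upto n (\<lambda>t s. deriv_fun f s + t *\<^sub>R deriv_fun \<xi> s) (deriv_fun \<xi>)"
    using Suc smooth_deriv_fun by blast
  moreover have "first_variation (\<lambda>t s. f s + t *\<^sub>R \<xi> s) \<xi>"
    using variation_upto_first[OF Suc.IH[OF Suc.prems]] .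
  ultimately show ?case
    using smooth_differentiable[OF Suc.prems(2)] differentiableI_vector[OF deriv]
    by (simp add: vector_derivative_at[OF deriv])
qed

lemma variation_upto_static: "smooth f \<Longrightarrow> variation_upto n (\<lambda>t. f) (\<lambda>s. 0)"
  using variation_upto_affine[OF _ smooth_const, of f n 0] by simp

lemma variation_upto_scaleR:
  assumes "variation_upto n F Z"
  shows "variation_upto n (\<lambda>t s. c *\<^sub>R F t s) (\<lambda>s. c *\<^sub>R Z s)"
  using variation_upto_bilinear[OF bounded_bilinear_scaleR
      variation_upto_static[OF smooth_const, of n c] assms] by simp

lemma variation_upto_uminus:
  "variation_upto n F Z \<Longrightarrow> variation_upto n (\<lambda>t s. - F t s) (\<lambda>s. - Z s)"
  using variation_upto_scaleR[of n F Z "-1"] by simp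

text \<open>The factor \<open>1 / \<bar>V\<bar>\<close> turns derivatives in the parameter of a curve with velocity \<open>V\<close> into
derivatives in arclength. Its difference quotient becomes a rational expression in \<open>V\<close>, \<open>\<bar>V\<bar>\<close>
and the difference quotient of \<open>V\<close> by \<open>\<bar>a\<bar>\<^sup>2 - \<bar>b\<bar>\<^sup>2 = (a - b) \<bullet> (a + b)\<close>.\<close>

lemma first_variation_inverse_norm:
  fixes V :: "real \<Rightarrow> real \<Rightarrow> 'a::real_inner"
  assumes V: "first_variation V Z" and nz: "\<And>s. V 0 s \<noteq> 0"
  shows "first_variation (\<lambda>t s. inverse (norm (V t s)))
    (\<lambda>s. - (inverse (norm (V 0 s)) ^ 3 * (V 0 s \<bullet> Z s)))"
  unfolding first_variation_def
proof (intro allI conjI)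
  fix s
  show "isCont (\<lambda>s. inverse (norm (V 0 s))) s"
    using V nz by (auto simp: first_variation_def intro!: continuous_inverse continuous_norm)
  \<comment> \<open>This fails for \<open>a = 0\<close>, so the limit below only uses it where \<open>V t\<close> does not vanish.\<close>
  have quotient: "(inverse (norm a) - inverse (norm b)) /\<^sub>R t
      = - (((a - b) /\<^sub>R t) \<bullet> (a + b)) * inverse (norm a) * inverse (norm b) * inverse (norm a + norm b)"
    if "a \<noteq> 0" "b \<noteq> 0" for a b :: 'a and t :: real
  proof -
    have "(a - b) \<bullet> (a + b) = (norm a - norm b) * (norm a + norm b)"
      by (simp add: inner_diff_left inner_add_right inner_commute dot_square_norm algebra_simps power2_eq_square)
    moreover have "norm a + norm b \<noteq> 0"
      using that by (metis add_nonneg_eq_0_iff norm_eq_zero norm_ge_zero)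
    moreover have "- (((a - b) /\<^sub>R t) \<bullet> (a + b)) = - ((a - b) \<bullet> (a + b)) / t"
      by (simp add: divide_inverse)
    ultimately show ?thesis
      using that by (simp add: divide_simps)
  qed
  have limV: "((\<lambda>p. V (fst p) (snd p)) \<longlongrightarrow> V 0 s) (at 0 \<times>\<^sub>F nhds s)"
    "((\<lambda>p. V 0 (snd p)) \<longlongrightarrow> V 0 s) (at 0 \<times>\<^sub>F nhds s)"
    by (rule first_variation_tendsto[OF V], rule first_variation_base_tendsto[OF V])
  have lim: "((\<lambda>p. - (((V (fst p) (snd p) - V 0 (snd p)) /\<^sub>R fst p) \<bullet> (V (fst p) (snd p) + V 0 (snd p)))
        * inverse (norm (V (fst p) (snd p))) * inverse (norm (V 0 (snd p)))
        * inverse (norm (V (fst p) (snd p)) + norm (V 0 (snd p))))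
      \<longlongrightarrow> - (Z s \<bullet> (V 0 s + V 0 s)) * inverse (norm (V 0 s)) * inverse (norm (V 0 s))
        * inverse (norm (V 0 s) + norm (V 0 s))) (at 0 \<times>\<^sub>F nhds s)"
    using V nz[of s] by (intro tendsto_intros limV) (auto simp: first_variation_def)
  have "- (Z s \<bullet> (V 0 s + V 0 s)) * inverse (norm (V 0 s)) * inverse (norm (V 0 s))
        * inverse (norm (V 0 s) + norm (V 0 s)) = - (inverse (norm (V 0 s)) ^ 3 * (V 0 s \<bullet> Z s))"
    using nz[of s] by (simp add: field_simps inner_add_right inner_commute power3_eq_cube)
  note lim' = lim[unfolded this]
  show "((\<lambda>p. (inverse (norm (V (fst p) (snd p))) - inverse (norm (V 0 (snd p)))) /\<^sub>R fst p)
      \<longlongrightarrow> - (inverse (norm (V 0 s)) ^ 3 * (V 0 s \<bullet> Z s))) (at 0 \<times>\<^sub>F nhds s)"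
  proof (rule Lim_transform_eventually[OF lim'])
    show "\<forall>\<^sub>F p in at 0 \<times>\<^sub>F nhds s.
        - (((V (fst p) (snd p) - V 0 (snd p)) /\<^sub>R fst p) \<bullet> (V (fst p) (snd p) + V 0 (snd p)))
          * inverse (norm (V (fst p) (snd p))) * inverse (norm (V 0 (snd p)))
          * inverse (norm (V (fst p) (snd p)) + norm (V 0 (snd p)))
        = (inverse (norm (V (fst p) (snd p))) - inverse (norm (V 0 (snd p)))) /\<^sub>R fst p"
      using tendsto_imp_eventually_ne[OF limV(1) nz]
      by (rule eventually_mono) (rule quotient[symmetric], use nz in auto)
  qed
qed

lemma has_vector_derivative_inverse_norm:
  fixes f :: "real \<Rightarrow> 'a::real_inner"
  assumes "f differentiable at s" "f s \<noteq> 0"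
  shows "((\<lambda>s. inverse (norm (f s))) has_vector_derivative
    - (inverse (norm (f s)) ^ 3 * (f s \<bullet> deriv_fun f s))) (at s)"
proof -
  have "(f has_derivative (\<lambda>h. h *\<^sub>R deriv_fun f s)) (at s)"
    using assms(1) by (simp add: vector_derivative_works has_vector_derivative_def)
  from Deriv.has_derivative_inverse[OF _ has_derivative_compose[OF this has_derivative_norm[OF assms(2)]]]
  have "((\<lambda>s. inverse (norm (f s))) has_derivative
      (\<lambda>h. - (inverse (norm (f s)) * ((h *\<^sub>R deriv_fun f s) \<bullet> sgn (f s)) * inverse (norm (f s))))) (at s)"
    using assms(2) by simp
  then show ?thesis
    unfolding has_vector_derivative_def
    by (simp add: sgn_div_norm inner_commute power3_eq_cube algebra_simps)
qed

text \<open>Punctured limits in \<open>t\<close> say nothing about \<open>t = 0\<close>; this brings them to full neighbourhoods of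
\<open>(0, s)\<close>, which is where regularity conditions are formulated.\<close>

lemma eventually_nhds_pair:
  assumes "eventually P (at (0::real) \<times>\<^sub>F nhds (s::real))"
  shows "\<forall>\<^sub>F p in nhds (0, s). fst p \<noteq> 0 \<longrightarrow> P p"
proof -
  from assms obtain A B where AB: "eventually A (at (0::real))" "eventually B (nhds s)"
    "\<And>t u. A t \<Longrightarrow> B u \<Longrightarrow> P (t, u)"
    by (auto simp: eventually_prod_filter)
  from AB(1) have "\<forall>\<^sub>F t in nhds 0. t \<noteq> 0 \<longrightarrow> A t"
    by (simp add: eventually_at_filter)
  then show ?thesis
    unfolding nhds_prod eventually_prod_filter using AB(2,3) by (auto intro!: exI)
qed

lemma first_variation_tendsto_nhds:
  fixes F :: "real \<Rightarrow> real \<Rightarrow> 'a::real_normed_vector"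
  assumes "first_variation F Z"
  shows "((\<lambda>p. F (fst p) (snd p)) \<longlongrightarrow> F 0 s) (nhds (0, s))"
proof (rule tendstoI)
  fix e :: real
  assume e: "e > 0"
  have "\<forall>\<^sub>F u in nhds s. dist (F 0 u) (F 0 s) < e"
    using assms e unfolding first_variation_def isCont_def tendsto_at_iff_tendsto_nhds
    by (auto dest: tendstoD)
  moreover have "filterlim snd (nhds s) (nhds (0::real, s))"
    unfolding nhds_prod by (rule filterlim_snd)
  ultimately have base: "\<forall>\<^sub>F p in nhds (0::real, s). dist (F 0 (snd p)) (F 0 s) < e"
    by (rule eventually_compose_filterlim)
  have "\<forall>\<^sub>F p in at 0 \<times>\<^sub>F nhds s. dist (F (fst p) (snd p)) (F 0 s) < e"
    using first_variation_tendsto[OF assms] e by (simp add: tendsto_iff)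
  from eventually_nhds_pair[OF this] base
  show "\<forall>\<^sub>F p in nhds (0, s). dist (F (fst p) (snd p)) (F 0 s) < e"
  proof eventually_elim
    case (elim p)
    then show ?case by (cases "fst p = 0") simp_all
  qed
qed

text \<open>With \<open>r = 1 / \<bar>V\<bar>\<close> one has \<open>r' = - r\<^sup>3 (V \<bullet> V')\<close>, a product in which \<open>r\<close> itself occurs
undifferentiated. Hence control of \<open>r\<close> up to order \<open>n\<close> gives control up to order \<open>n + 1\<close>.\<close>

lemma variation_upto_inverse_norm:
  fixes V :: "real \<Rightarrow> real \<Rightarrow> 'a::real_inner"
  assumes "variation_upto n V Z" and nz: "\<And>s. V 0 s \<noteq> 0"
  shows "variation_upto n (\<lambda>t s. inverse (norm (V t s)))
    (\<lambda>s. - (inverse (norm (V 0 s)) ^ 3 * (V 0 s \<bullet> Z s)))"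
  using assms(1)
proof (induction n)
  case 0
  then show ?case using first_variation_inverse_norm nz by auto
next
  case (Suc n)
  define r where "r = (\<lambda>t s. inverse (norm (V t s)))"
  define w where "w = (\<lambda>s. - (r 0 s ^ 3 * (V 0 s \<bullet> Z s)))"
  note deriv_r = has_vector_derivative_inverse_norm[folded r_def]
  have diff0: "V 0 differentiable at s" "Z differentiable at s" for s
    using variation_upto_Suc_differentiable[OF Suc.prems] by simp_all
  have reg: "\<forall>\<^sub>F p in nhds (0, s). V (fst p) differentiable at (snd p) \<and> V (fst p) (snd p) \<noteq> 0" for s
    using Suc.prems tendsto_imp_eventually_ne[OF first_variation_tendsto_nhds[OF variation_upto_first[OF Suc.prems]] nz]
    by (intro eventually_conj) simp_all
  have r: "variation_upto n r w"
    using Suc.IH variation_upto_SucD[OF Suc.prems] by (simp add: r_def w_def)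
  have V: "variation_upto n V Z" "variation_upto n (\<lambda>t. deriv_fun (V t)) (deriv_fun Z)"
    using Suc.prems variation_upto_SucD[OF Suc.prems] by simp_all
  note mult = variation_upto_bilinear[OF bounded_bilinear_mult]
  have "variation_upto n (\<lambda>t s. - ((r t s * (r t s * r t s)) * (V t s \<bullet> deriv_fun (V t) s)))
     (\<lambda>s. - ((w s * (r 0 s * r 0 s) + r 0 s * (w s * r 0 s + r 0 s * w s)) * (V 0 s \<bullet> deriv_fun (V 0) s)
        + (r 0 s * (r 0 s * r 0 s)) * (Z s \<bullet> deriv_fun (V 0) s + V 0 s \<bullet> deriv_fun Z s)))"
    by (intro variation_upto_uminus mult r variation_upto_bilinear[OF bounded_bilinear_inner V])
  moreover have "locally_equal (\<lambda>t s. - ((r t s * (r t s * r t s)) * (V t s \<bullet> deriv_fun (V t) s)))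
      (\<lambda>t. deriv_fun (\<lambda>s. r t s))"
    unfolding locally_equal_def
  proof
    fix s
    show "\<forall>\<^sub>F p in nhds (0, s). - ((r (fst p) (snd p) * (r (fst p) (snd p) * r (fst p) (snd p)))
          * (V (fst p) (snd p) \<bullet> deriv_fun (V (fst p)) (snd p))) = deriv_fun (\<lambda>s. r (fst p) s) (snd p)"
      using reg[of s]
    proof (rule eventually_mono)
      fix p
      assume p: "V (fst p) differentiable at (snd p) \<and> V (fst p) (snd p) \<noteq> 0"
      show "- ((r (fst p) (snd p) * (r (fst p) (snd p) * r (fst p) (snd p)))
          * (V (fst p) (snd p) \<bullet> deriv_fun (V (fst p)) (snd p))) = deriv_fun (\<lambda>s. r (fst p) s) (snd p)"
        using vector_derivative_at[OF has_vector_derivative_inverse_norm[of "V (fst p)" "snd p"]] p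
        by (simp add: r_def power3_eq_cube)
    qed
  qed
  ultimately have "variation_upto n (\<lambda>t. deriv_fun (\<lambda>s. r t s))
     (\<lambda>s. - ((w s * (r 0 s * r 0 s) + r 0 s * (w s * r 0 s + r 0 s * w s)) * (V 0 s \<bullet> deriv_fun (V 0) s)
        + (r 0 s * (r 0 s * r 0 s)) * (Z s \<bullet> deriv_fun (V 0) s + V 0 s \<bullet> deriv_fun Z s)))"
    by (rule variation_upto_cong)
  moreover have deriv_w: "(w has_vector_derivative
      - ((w s * (r 0 s * r 0 s) + r 0 s * (w s * r 0 s + r 0 s * w s)) * (V 0 s \<bullet> deriv_fun (V 0) s)
        + (r 0 s * (r 0 s * r 0 s)) * (Z s \<bullet> deriv_fun (V 0) s + V 0 s \<bullet> deriv_fun Z s))) (at s)" for s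
  proof -
    have "(r 0 has_vector_derivative - (r 0 s ^ 3 * (V 0 s \<bullet> deriv_fun (V 0) s))) (at s)"
      unfolding r_def using has_vector_derivative_inverse_norm[OF diff0(1) nz] by simp
    then have dr: "(r 0 has_field_derivative - (r 0 s ^ 3 * (V 0 s \<bullet> deriv_fun (V 0) s))) (at s)"
      by (simp add: has_real_derivative_iff_has_vector_derivative)
    have di: "((\<lambda>s. V 0 s \<bullet> Z s) has_field_derivative
        (deriv_fun (V 0) s \<bullet> Z s + V 0 s \<bullet> deriv_fun Z s)) (at s)"
      using has_vector_derivative_bilinear[OF bounded_bilinear_inner diff0, of s]
      by (simp add: has_real_derivative_iff_has_vector_derivative)
    have "(w has_field_derivative - (3 * r 0 s ^ 2 * - (r 0 s ^ 3 * (V 0 s \<bullet> deriv_fun (V 0) s)) * (V 0 s \<bullet> Z s)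
        + r 0 s ^ 3 * (deriv_fun (V 0) s \<bullet> Z s + V 0 s \<bullet> deriv_fun Z s))) (at s)"
      unfolding w_def by (auto intro!: derivative_eq_intros dr di simp: algebra_simps)
    moreover have "- (3 * r 0 s ^ 2 * - (r 0 s ^ 3 * (V 0 s \<bullet> deriv_fun (V 0) s)) * (V 0 s \<bullet> Z s)
        + r 0 s ^ 3 * (deriv_fun (V 0) s \<bullet> Z s + V 0 s \<bullet> deriv_fun Z s))
      = - ((w s * (r 0 s * r 0 s) + r 0 s * (w s * r 0 s + r 0 s * w s)) * (V 0 s \<bullet> deriv_fun (V 0) s)
        + (r 0 s * (r 0 s * r 0 s)) * (Z s \<bullet> deriv_fun (V 0) s + V 0 s \<bullet> deriv_fun Z s))"
      by (simp add: w_def inner_commute algebra_simps power2_eq_square power3_eq_cube)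
    ultimately show ?thesis
      by (simp add: has_real_derivative_iff_has_vector_derivative)
  qed
  ultimately have "variation_upto n (\<lambda>t. deriv_fun (r t)) (deriv_fun w)"
    by (simp add: vector_derivative_at[OF deriv_w])
  moreover have "\<forall>\<^sub>F p in nhds (0, s). r (fst p) differentiable at (snd p)" for s
    using reg[of s]
    by (rule eventually_mono)
      (use has_vector_derivative_inverse_norm in \<open>auto simp: r_def intro: differentiableI_vector\<close>)
  ultimately have "variation_upto (Suc n) r w"
    using variation_upto_first[OF r] differentiableI_vector[OF deriv_w] by simp
  then show ?case by (simp add: r_def w_def)
qed

section \<open>Convergence in the Frechet topology\<close>

lemma nth_derivative_cong:
  assumes "\<forall>\<^sub>F u in nhds s. f u = g u"
  shows "nth_derivative n f s = nth_derivative n g s"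
  using assms
proof (induction n arbitrary: f g)
  case 0
  then show ?case by (auto simp: nth_derivative_0 dest: eventually_nhds_x_imp_x)
next
  case (Suc n)
  have "\<forall>\<^sub>F v in nhds s. \<forall>\<^sub>F u in nhds v. f u = g u"
    using Suc.prems by (simp add: eventually_eventually)
  then have "\<forall>\<^sub>F v in nhds s. deriv_fun f v = deriv_fun g v"
    by (rule eventually_mono) (rule deriv_fun_cong)
  then show ?case unfolding nth_derivative_Suc by (rule Suc.IH)
qed

lemma variation_upto_nth_derivative:
  "variation_upto n F Z \<Longrightarrow> first_variation (\<lambda>t. nth_derivative n (F t)) (nth_derivative n Z)"
  by (induction n arbitrary: F Z) (simp_all add: nth_derivative_0 nth_derivative_Suc)

text \<open>Near \<open>t = 0\<close> the functions \<open>F t\<close> are differentiable often enough for the derivatives of the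
difference quotient to be the difference quotients of the derivatives.\<close>

lemma nth_derivative_difference_quotient:
  assumes "variation_upto n F Z"
  shows "\<forall>\<^sub>F p in nhds (0, s). nth_derivative n (\<lambda>u. (F (fst p) u - F 0 u) /\<^sub>R fst p) (snd p)
    = (nth_derivative n (F (fst p)) (snd p) - nth_derivative n (F 0) (snd p)) /\<^sub>R fst p"
  using assms
proof (induction n arbitrary: F Z)
  case 0
  then show ?case by (simp add: nth_derivative_0)
next
  case (Suc n)
  define Q where "Q = (\<lambda>t u. (F t u - F 0 u) /\<^sub>R t)"
  have "\<forall>\<^sub>F p in nhds (0, s). F (fst p) differentiable at (snd p)"
    using Suc.prems by simp
  then have "\<forall>\<^sub>F p in nhds (0, s). deriv_fun (Q (fst p)) (snd p)
      = (deriv_fun (F (fst p)) (snd p) - deriv_fun (F 0) (snd p)) /\<^sub>R fst p"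
  proof (rule eventually_mono)
    fix p :: "real \<times> real"
    assume "F (fst p) differentiable at (snd p)"
    then have "(Q (fst p) has_vector_derivative
        (deriv_fun (F (fst p)) (snd p) - deriv_fun (F 0) (snd p)) /\<^sub>R fst p) (at (snd p))"
      unfolding Q_def using variation_upto_Suc_differentiable(1)[OF Suc.prems, of "snd p"]
      by (auto simp: vector_derivative_works intro!: derivative_eq_intros)
    then show "deriv_fun (Q (fst p)) (snd p)
      = (deriv_fun (F (fst p)) (snd p) - deriv_fun (F 0) (snd p)) /\<^sub>R fst p"
      by (rule vector_derivative_at)
  qed
  then have "\<forall>\<^sub>F p in nhds (0, s). \<forall>\<^sub>F q in nhds p. deriv_fun (Q (fst q)) (snd q)
      = (deriv_fun (F (fst q)) (snd q) - deriv_fun (F 0) (snd q)) /\<^sub>R fst q"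
    by (simp add: eventually_eventually)
  moreover have "\<forall>\<^sub>F p in nhds (0, s).
      nth_derivative n (\<lambda>u. (deriv_fun (F (fst p)) u - deriv_fun (F 0) u) /\<^sub>R fst p) (snd p)
      = (nth_derivative n (deriv_fun (F (fst p))) (snd p) - nth_derivative n (deriv_fun (F 0)) (snd p)) /\<^sub>R fst p"
    using Suc.prems Suc.IH[of "\<lambda>t. deriv_fun (F t)" "deriv_fun Z"] by simp
  ultimately have "\<forall>\<^sub>F p in nhds (0, s). nth_derivative n (deriv_fun (Q (fst p))) (snd p)
      = (nth_derivative n (deriv_fun (F (fst p))) (snd p) - nth_derivative n (deriv_fun (F 0)) (snd p)) /\<^sub>R fst p"
  proof eventually_elim
    case (elim p)
    have "nth_derivative n (deriv_fun (Q (fst p))) (snd p)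
      = nth_derivative n (\<lambda>u. (deriv_fun (F (fst p)) u - deriv_fun (F 0) u) /\<^sub>R fst p) (snd p)"
      using eventually_slice[OF elim(1)] by (intro nth_derivative_cong) simp
    with elim(2) show ?case by simp
  qed
  then show ?case by (simp add: nth_derivative_Suc Q_def)
qed

lemma variation_upto_Suc_nth_differentiable:
  assumes "variation_upto (Suc n) F Z"
  shows "nth_derivative n (F 0) differentiable at s \<and> nth_derivative n Z differentiable at s"
  using assms
proof (induction n arbitrary: F Z)
  case 0
  then show ?case
    using variation_upto_Suc_differentiable[OF 0] by (simp add: nth_derivative_0)
next
  case (Suc n)
  from Suc.prems have "variation_upto (Suc n) (\<lambda>t. deriv_fun (F t)) (deriv_fun Z)"
    unfolding variation_upto.simps(2)[of "Suc n"] by blast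
  then show ?case unfolding nth_derivative_Suc by (rule Suc.IH)
qed

lemma smooth_variation_smooth:
  assumes "smooth_variation F Z"
  shows "smooth (F 0)" "smooth Z"
proof -
  have "nth_derivative n (F 0) differentiable at s \<and> nth_derivative n Z differentiable at s" for n s
    using assms by (intro variation_upto_Suc_nth_differentiable) (simp add: smooth_variation_def)
  then show "smooth (F 0)" "smooth Z" by (simp_all add: smooth_def)
qed

text \<open>The tube lemma in the language of filters.\<close>

lemma eventually_compact_prod:
  fixes K :: "'b::topological_space set"
  assumes "compact K" and "\<And>s. s \<in> K \<Longrightarrow> \<forall>\<^sub>F p in F \<times>\<^sub>F nhds s. P (fst p) (snd p)"
  shows "\<forall>\<^sub>F t in F. \<forall>s\<in>K. P t s"
proof -
  have "\<exists>A U. eventually A F \<and> open U \<and> s \<in> U \<and> (\<forall>t u. A t \<longrightarrow> u \<in> U \<longrightarrow> P t u)" if "s \<in> K" for s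
  proof -
    from assms(2)[OF that] obtain A B where AB: "eventually A F" "eventually B (nhds s)"
      "\<And>t u. A t \<Longrightarrow> B u \<Longrightarrow> P t u"
      by (auto simp: eventually_prod_filter)
    moreover from AB(2) obtain U where "open U" "s \<in> U" "\<forall>u\<in>U. B u"
      by (auto simp: eventually_nhds)
    ultimately show ?thesis by blast
  qed
  then obtain A U where AU: "\<And>s. s \<in> K \<Longrightarrow> eventually (A s) F \<and> open (U s) \<and> s \<in> U s \<and>
      (\<forall>t u. A s t \<longrightarrow> u \<in> U s \<longrightarrow> P t u)"
    by metis
  have "K \<subseteq> (\<Union>s\<in>K. U s)" using AU by blast
  then obtain J where J: "J \<subseteq> K" "finite J" "K \<subseteq> (\<Union>s\<in>J. U s)"
    using compactE_image[OF assms(1), of K U] AU by blast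
  have "\<forall>\<^sub>F t in F. \<forall>s\<in>J. A s t"
    using J AU by (intro eventually_ball_finite) auto
  then show ?thesis
    by (rule eventually_mono) (use J AU in blast)
qed

lemma smooth_variation_uniform_limit:
  fixes F :: "real \<Rightarrow> real \<Rightarrow> 'a::real_normed_vector"
  assumes "smooth_variation F Z" "compact K"
  shows "uniform_limit K (\<lambda>t. nth_derivative n (\<lambda>s. (F t s - F 0 s) /\<^sub>R t)) (nth_derivative n Z) (at 0)"
proof (rule uniform_limitI)
  fix e :: real
  assume e: "e > 0"
  have var: "variation_upto n F Z" using assms(1) by (simp add: smooth_variation_def)
  show "\<forall>\<^sub>F t in at 0. \<forall>s\<in>K. dist (nth_derivative n (\<lambda>s. (F t s - F 0 s) /\<^sub>R t) s) (nth_derivative n Z s) < e"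
  proof (rule eventually_compact_prod[OF assms(2)])
    fix s
    define q where "q = (\<lambda>p. (nth_derivative n (F (fst p)) (snd p) - nth_derivative n (F 0) (snd p)) /\<^sub>R fst p)"
    have "(q \<longlongrightarrow> nth_derivative n Z s) (at 0 \<times>\<^sub>F nhds s)"
      using variation_upto_nth_derivative[OF var] by (simp add: first_variation_def q_def)
    moreover have "((\<lambda>p. nth_derivative n Z (snd p)) \<longlongrightarrow> nth_derivative n Z s) (at (0::real) \<times>\<^sub>F nhds s)"
    proof (rule filterlim_compose[OF _ filterlim_snd])
      have "nth_derivative n Z differentiable at s"
        using smooth_variation_smooth(2)[OF assms(1)] by (simp add: smooth_def)
      then show "(nth_derivative n Z \<longlongrightarrow> nth_derivative n Z s) (nhds s)"
        using differentiable_imp_continuous_within[of "nth_derivative n Z" s UNIV]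
        by (auto simp: isCont_def tendsto_at_iff_tendsto_nhds)
    qed
    ultimately have "((\<lambda>p. dist (q p) (nth_derivative n Z (snd p))) \<longlongrightarrow>
        dist (nth_derivative n Z s) (nth_derivative n Z s)) (at 0 \<times>\<^sub>F nhds s)"
      by (rule tendsto_dist)
    then have "\<forall>\<^sub>F p in at 0 \<times>\<^sub>F nhds s. dist (q p) (nth_derivative n Z (snd p)) < e"
      using e by (intro order_tendstoD(2)) simp_all
    moreover note filter_leD[OF at_nhds_le_nhds nth_derivative_difference_quotient[OF var, of s]]
    ultimately show "\<forall>\<^sub>F p in at 0 \<times>\<^sub>F nhds s.
      dist (nth_derivative n (\<lambda>s. (F (fst p) s - F 0 s) /\<^sub>R fst p) (snd p)) (nth_derivative n Z (snd p)) < e"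
      by eventually_elim (simp add: q_def)
  qed
qed

lemma smooth_variation_deriv_fun:
  assumes "smooth_variation F Z"
  shows "smooth_variation (\<lambda>t. deriv_fun (F t)) (deriv_fun Z)"
  unfolding smooth_variation_def
proof
  fix n
  show "variation_upto n (\<lambda>t. deriv_fun (F t)) (deriv_fun Z)"
    using assms[unfolded smooth_variation_def, rule_format, of "Suc n"] by simp
qed

lemma smooth_variation_bilinear:
  assumes "bounded_bilinear B" "smooth_variation F Z" "smooth_variation G W"
  shows "smooth_variation (\<lambda>t s. B (F t s) (G t s)) (\<lambda>s. B (Z s) (G 0 s) + B (F 0 s) (W s))"
  using assms variation_upto_bilinear unfolding smooth_variation_def by blast

lemma smooth_variation_scaleR:
  "smooth_variation F Z \<Longrightarrow> smooth_variation (\<lambda>t s. c *\<^sub>R F t s) (\<lambda>s. c *\<^sub>R Z s)"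
  by (simp add: smooth_variation_def variation_upto_scaleR)

lemma smooth_variation_diff:
  assumes "smooth_variation F Z" "smooth_variation G W"
  shows "smooth_variation (\<lambda>t s. F t s - G t s) (\<lambda>s. Z s - W s)"
  using assms variation_upto_add[OF _ variation_upto_uminus, of _ F Z G W]
  by (simp add: smooth_variation_def)

lemma smooth_variation_sum:
  assumes "finite I" "\<And>i. i \<in> I \<Longrightarrow> smooth_variation (F i) (Z i)"
  shows "smooth_variation (\<lambda>t s. \<Sum>i\<in>I. F i t s) (\<lambda>s. \<Sum>i\<in>I. Z i s)"
  using assms
proof (induction I rule: finite_induct)
  case empty
  then show ?case
    unfolding smooth_variation_def using variation_upto_static[OF smooth_const] by auto
next
  case (insert i I)
  then show ?case
    using variation_upto_add[of _ "F i" "Z i"] unfolding smooth_variation_def by simp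
qed

text \<open>The arclength form \<open>dx\<close> of \<open>G t\<close> varies by \<open>(T \<bullet> \<xi>') dx\<close>, so variation and arclength derivative
commute up to the second term, which disappears when \<open>\<xi>\<close> preserves arclength.\<close>

lemma smooth_variation_arclength_derivative:
  assumes G: "smooth_variation G \<xi>" and immersion: "\<And>s. deriv_fun (G 0) s \<noteq> 0"
    and F: "smooth_variation F Z"
  shows "smooth_variation (\<lambda>t. arclength_derivative (G t) (F t))
    (\<lambda>s. arclength_derivative (G 0) Z s
      - (unit_tangent (G 0) s \<bullet> arclength_derivative (G 0) \<xi> s) *\<^sub>R arclength_derivative (G 0) (F 0) s)"
proof -
  have "smooth_variation (\<lambda>t s. inverse (norm (deriv_fun (G t) s)))
      (\<lambda>s. - (inverse (norm (deriv_fun (G 0) s)) ^ 3 * (deriv_fun (G 0) s \<bullet> deriv_fun \<xi> s)))"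
    using variation_upto_inverse_norm[where V = "\<lambda>t. deriv_fun (G t)"] immersion
      smooth_variation_deriv_fun[OF G]
    unfolding smooth_variation_def by simp
  from smooth_variation_bilinear[OF bounded_bilinear_scaleR this smooth_variation_deriv_fun[OF F]]
  show ?thesis
    by (simp add: arclength_derivative_def[abs_def] unit_tangent_def power3_eq_cube algebra_simps)
qed

lemma bounded_bilinear_cross3: "bounded_bilinear cross3"
  using bilinear_cross bilinear_conv_bounded_bilinear by blast

text \<open>The index \<open>k - i + 1\<close> in the recursion simplifies to a successor, so that the equation, as a
rewrite rule, would unfold itself without end.\<close>

declare Y.simps(2) [simp del]

text \<open>The Leibniz rule applied to the recursion, with the variation of the arclength form taken into
account. The direction \<open>\<xi>\<close> is arbitrary, so that the lemma serves both for the smoothness of the fields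
and for their variation in the directions \<open>Y\<^sub>l\<close>.\<close>

lemma smooth_variation_Y_Suc:
  assumes G: "smooth_variation G \<xi>" and immersion: "\<And>s. deriv_fun (G 0) s \<noteq> 0"
    and Y: "\<And>i. i \<le> k \<Longrightarrow> smooth_variation (\<lambda>t. Y i (G t)) (Z i)"
  shows "smooth_variation (\<lambda>t. Y (Suc k) (G t)) (\<lambda>s.
    (cross3 (Z 0 s) (arclength_derivative (G 0) (Y k (G 0)) s)
      + cross3 (unit_tangent (G 0) s) (arclength_derivative (G 0) (Z k) s
        - (unit_tangent (G 0) s \<bullet> arclength_derivative (G 0) \<xi> s) *\<^sub>R
            arclength_derivative (G 0) (Y k (G 0)) s))
    - (((1/2) *\<^sub>R (\<Sum>i = 1..k. Z i s \<bullet> Y (k - i + 1) (G 0) s + Y i (G 0) s \<bullet> Z (k - i + 1) s)) *\<^sub>R unit_tangent (G 0) s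
      + ((1/2) *\<^sub>R (\<Sum>i = 1..k. Y i (G 0) s \<bullet> Y (k - i + 1) (G 0) s)) *\<^sub>R Z 0 s))"
proof -
  have T: "smooth_variation (\<lambda>t. unit_tangent (G t)) (Z 0)"
    using Y[of 0] by simp
  have "smooth_variation (\<lambda>t s. \<Sum>i = 1..k. Y i (G t) s \<bullet> Y (k - i + 1) (G t) s)
      (\<lambda>s. \<Sum>i = 1..k. Z i s \<bullet> Y (k - i + 1) (G 0) s + Y i (G 0) s \<bullet> Z (k - i + 1) s)"
    by (intro smooth_variation_sum smooth_variation_bilinear[OF bounded_bilinear_inner] Y) auto
  then have "smooth_variation (\<lambda>t s. (1/2) *\<^sub>R (\<Sum>i = 1..k. Y i (G t) s \<bullet> Y (k - i + 1) (G t) s))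
      (\<lambda>s. (1/2) *\<^sub>R (\<Sum>i = 1..k. Z i s \<bullet> Y (k - i + 1) (G 0) s + Y i (G 0) s \<bullet> Z (k - i + 1) s))"
    by (rule smooth_variation_scaleR)
  from smooth_variation_diff[OF
      smooth_variation_bilinear[OF bounded_bilinear_cross3 T
        smooth_variation_arclength_derivative[OF G immersion Y[OF order_refl]]]
      smooth_variation_bilinear[OF bounded_bilinear_scaleR this T]]
  show ?thesis unfolding Y.simps(2) real_scaleR_def by simp
qed

text \<open>Only the existence of a variation is asserted, for an arbitrary smooth deformation. Applied to the
constant deformation of a curve it yields the smoothness of the fields along that curve, which is
needed before they can serve as directions of deformation.\<close>

lemma smooth_variation_Y_exists:
  assumes G: "smooth_variation G \<xi>" and immersion: "\<And>s. deriv_fun (G 0) s \<noteq> 0"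
  shows "\<exists>Z. smooth_variation (\<lambda>t. Y k (G t)) Z"
proof (induction k rule: less_induct)
  case (less k)
  show ?case
  proof (cases k)
    case 0
    have "smooth_variation (\<lambda>t. unit_tangent (G t)) (\<lambda>s. arclength_derivative (G 0) \<xi> s
      - (unit_tangent (G 0) s \<bullet> arclength_derivative (G 0) \<xi> s) *\<^sub>R arclength_derivative (G 0) (G 0) s)"
      unfolding unit_tangent_def
      using smooth_variation_arclength_derivative[OF G immersion G] by (simp add: unit_tangent_def)
    then show ?thesis using 0 by auto
  next
    case (Suc m)
    from less[unfolded Suc] obtain Z where "\<And>i. i \<le> m \<Longrightarrow> smooth_variation (\<lambda>t. Y i (G t)) (Z i)"
      by (metis less_Suc_eq_le)
    from smooth_variation_Y_Suc[OF G immersion this] show ?thesis unfolding Suc by blast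
  qed
qed

lemma smooth_Y:
  assumes "smooth \<gamma>" "\<And>s. deriv_fun \<gamma> s \<noteq> 0"
  shows "smooth (Y k \<gamma>)"
proof -
  have "smooth_variation (\<lambda>t. \<gamma>) (\<lambda>s. 0)"
    using variation_upto_static[OF assms(1)] by (simp add: smooth_variation_def)
  from smooth_variation_Y_exists[OF this assms(2)] obtain Z
    where "smooth_variation (\<lambda>t. Y k \<gamma>) Z" by blast
  then show ?thesis by (rule smooth_variation_smooth(1))
qed

section \<open>Antisymmetric sums of cross products\<close>

unbundle cross3_syntax

text \<open>Reversal of the range of summation changes the sign. The shift \<open>c\<close> is present because in an inner
sum over \<open>i \<ge> m\<close> the skew expression is in \<open>i - m\<close> and \<open>n - i\<close>.\<close>

lemma sum_skew_eq_0:
  fixes f :: "nat \<Rightarrow> nat \<Rightarrow> 'a::real_vector"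
  assumes skew: "\<And>i j. f j i = - f i j"
  shows "(\<Sum>i = a..b. f (i - c) (a + b - i - c)) = 0"
proof -
  let ?S = "\<Sum>i = a..b. f (i - c) (a + b - i - c)"
  have "?S = (\<Sum>i = a..b. f (a + b - i - c) (a + b - (a + b - i) - c))"
    using sum.atLeastAtMost_rev[of "\<lambda>i. f (i - c) (a + b - i - c)" a b] by (simp add: add.commute)
  also have "\<dots> = (\<Sum>i = a..b. f (a + b - i - c) (i - c))"
    by (intro sum.cong) auto
  also have "\<dots> = (\<Sum>i = a..b. - f (i - c) (a + b - i - c))"
    by (intro sum.cong refl skew)
  also have "\<dots> = - ?S" by (rule sum_negf)
  finally have "2 *\<^sub>R ?S = 0" by (simp add: scaleR_2 eq_neg_iff_add_eq_0)
  then show ?thesis by simp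
qed

lemma triple_skew: "(x \<times> y) \<bullet> z = - ((x \<times> z) \<bullet> y)" for x y z :: "real^3"
  by (simp add: cross3_def inner_vec_def sum_3 algebra_simps)

text \<open>This is the coefficient of \<open>x\<^sup>k\<close> in \<open>(\<Sum>m. y (l + 1 + m) x\<^sup>m) \<times> (\<Sum>j. y j x\<^sup>j)\<close>. For
\<open>y k = Y\<^sub>k\<close> it is the derivative of \<open>Y\<^sub>k\<close> in direction \<open>Y\<^sub>l\<close>.\<close>

definition bracket_sum :: "(nat \<Rightarrow> real^3) \<Rightarrow> nat \<Rightarrow> nat \<Rightarrow> real^3" where
  "bracket_sum y l k = (\<Sum>m = 0..k. y (l + 1 + m) \<times> y (k - m))"

lemma bracket_sum_alt:
  "bracket_sum y l k = (\<Sum>i = l + 1..l + 1 + k. y i \<times> y (k + l + 1 - i))"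
  unfolding bracket_sum_def
  by (rule sum.reindex_bij_witness[where i = "\<lambda>i. i - (l + 1)" and j = "\<lambda>m. l + 1 + m"]) auto

text \<open>The algebraic core of the commutation. Both sides sum \<open>y i \<times> y j\<close> over \<open>i + j = k + l + 1\<close>, one with
\<open>i > l\<close> and the other with \<open>i > k\<close>. The indices \<open>i\<close> between \<open>l + 1\<close> and \<open>k\<close>, by which the ranges
differ, are permuted by \<open>i \<mapsto> j\<close>, so their contributions cancel in pairs.\<close>

lemma bracket_sum_commute: "bracket_sum y l k = bracket_sum y k l"
proof (induction l k rule: linorder_wlog)
  case (le l k)
  let ?f = "\<lambda>i. y i \<times> y (k + l + 1 - i)"
  have "(\<Sum>i = l + 1..l + 1 + k. ?f i) = (\<Sum>i = l + 1..k. ?f i) + (\<Sum>i = k + 1..l + 1 + k. ?f i)"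
    using sum.ub_add_nat[of "l + 1" k ?f "l + 1"] le by (simp add: add.commute)
  moreover have "l + 1 + k = k + l + 1" by simp
  then have "(\<Sum>i = l + 1..k. ?f i) = 0"
    using sum_skew_eq_0[of "\<lambda>i j. y i \<times> y j" 0 "l + 1" k, OF cross_skew]
    by (simp only: minus_nat.diff_0)
  ultimately show ?case
    by (simp add: bracket_sum_alt add_ac)
qed simp

text \<open>The linearisation of \<open>Y \<bullet> Y = 1\<close> for the generating series: a variation of the form \<open>P \<times> Y\<close> is
orthogonal to \<open>Y\<close>.\<close>

lemma bracket_sum_inner:
  "(\<Sum>i = 0..n. bracket_sum y l i \<bullet> y (n - i)) = 0"
proof -
  have "(\<Sum>i = 0..n. bracket_sum y l i \<bullet> y (n - i))
      = (\<Sum>i = 0..n. \<Sum>m = 0..i. (y (l + 1 + m) \<times> y (i - m)) \<bullet> y (n - i))"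
    by (simp add: bracket_sum_def inner_sum_left)
  also have "\<dots> = (\<Sum>m = 0..n. \<Sum>i = m..n. (y (l + 1 + m) \<times> y (i - m)) \<bullet> y (n - i))"
    unfolding sum.Sigma[OF finite_atLeastAtMost ballI[OF finite_atLeastAtMost]]
    by (rule sum.reindex_bij_witness[where i = prod.swap and j = prod.swap]) auto
  also have "\<dots> = (\<Sum>m = 0..n. 0)"
  proof (rule sum.cong[OF refl])
    fix m
    have "(\<Sum>i = m..n. (y (l + 1 + m) \<times> y (i - m)) \<bullet> y (m + n - i - m)) = 0"
      by (rule sum_skew_eq_0[of "\<lambda>p q. (y (l + 1 + m) \<times> y p) \<bullet> y q"]) (rule triple_skew)
    then show "(\<Sum>i = m..n. (y (l + 1 + m) \<times> y (i - m)) \<bullet> y (n - i)) = 0"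
      by (simp add: diff_right_commute)
  qed
  finally show ?thesis by simp
qed

text \<open>The linearisation of \<open>y'\<^sub>k + y\<^sub>0 \<times> y\<^sub>k\<^sub>+\<^sub>1 = 0\<close>, with the derivative of \<open>bracket_sum y l k\<close>
written out by the Leibniz rule. Since \<open>y\<^sub>0 \<times> _\<close> is a derivation of the cross product, almost
all terms of \<open>y\<^sub>0 \<times> bracket_sum y l (k + 1)\<close> match; the one left over is the first,
\<open>(y\<^sub>0 \<times> y\<^sub>l\<^sub>+\<^sub>1) \<times> y\<^sub>k\<^sub>+\<^sub>1\<close>.\<close>

lemma bracket_sum_derivative:
  assumes y': "\<And>j. y' j = - (y 0 \<times> y (Suc j))"
  shows "(\<Sum>m = 0..k. y' (l + 1 + m) \<times> y (k - m) + y (l + 1 + m) \<times> y' (k - m))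
    = - (bracket_sum y l 0 \<times> y (Suc k)) - y 0 \<times> bracket_sum y l (Suc k)"
proof -
  have leibniz: "y 0 \<times> (u \<times> v) = (y 0 \<times> u) \<times> v + u \<times> (y 0 \<times> v)" for u v
    by (simp add: Lagrange cross_skew[of "_ \<times> _"] inner_commute algebra_simps)
  have "y 0 \<times> bracket_sum y l (Suc k)
      = (\<Sum>m = 0..Suc k. y 0 \<times> (y (l + 1 + m) \<times> y (Suc k - m)))"
    unfolding bracket_sum_def
    using linear_sum[OF bounded_linear.linear[OF
          bounded_bilinear.bounded_linear_right[OF bounded_bilinear_cross3]]] by blast
  also have "\<dots> = (\<Sum>m = 0..Suc k. (y 0 \<times> y (l + 1 + m)) \<times> y (Suc k - m))
      + (\<Sum>m = 0..Suc k. y (l + 1 + m) \<times> (y 0 \<times> y (Suc k - m)))"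
    by (simp only: leibniz sum.distrib)
  also have "(\<Sum>m = 0..Suc k. y (l + 1 + m) \<times> (y 0 \<times> y (Suc k - m)))
      = - (\<Sum>m = 0..k. y (l + 1 + m) \<times> y' (k - m))"
    by (simp add: y' sum_negf Suc_diff_le)
  also have "(\<Sum>m = 0..Suc k. (y 0 \<times> y (l + 1 + m)) \<times> y (Suc k - m))
      = (y 0 \<times> y (l + 1)) \<times> y (Suc k) - (\<Sum>m = 0..k. y' (l + 1 + m) \<times> y (k - m))"
    by (simp add: sum.atLeast0_atMost_Suc_shift y' sum_negf del: sum.cl_ivl_Suc)
  finally show ?thesis
    by (simp add: bracket_sum_def sum.distrib cross_skew[of "y (Suc l)" "y 0"])
qed

text \<open>Here \<open>z\<close> is the variation of \<open>T\<close>, \<open>y = Y\<^sub>k\<^sub>+\<^sub>1\<close> and \<open>w\<close> the claimed variation of \<open>Y\<^sub>k\<^sub>+\<^sub>1\<close>. The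
two arguments of the cross products are \<open>Y\<^sub>k'\<close> and its variation, and the last bracket is what the
sums in the recursion contribute.\<close>

lemma linearised_recursion_solution:
  fixes T z y w :: "real^3"
  assumes "T \<bullet> T = 1" "T \<bullet> z = 0"
  shows "z \<times> (- (T \<times> y)) + T \<times> (- (z \<times> y) - T \<times> w) + ((z \<bullet> y + w \<bullet> T) *\<^sub>R T + (T \<bullet> y) *\<^sub>R z) = w"
  using assms
  by (simp add: Cross3.right_diff_distrib Lagrange inner_commute algebra_simps)

section \<open>The hierarchy along an immersed curve\<close>

lemma arclength_derivativeI:
  assumes "(f has_vector_derivative norm (deriv_fun \<gamma> s) *\<^sub>R v) (at s)" "deriv_fun \<gamma> s \<noteq> 0"
  shows "arclength_derivative \<gamma> f s = v"
  using assms by (simp add: arclength_derivative_def vector_derivative_at)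

lemma arclength_derivative_sum_bilinear:
  assumes B: "bounded_bilinear B" and immersion: "deriv_fun \<gamma> s \<noteq> 0"
    and "\<And>i. i \<in> I \<Longrightarrow> f i differentiable at s" "\<And>i. i \<in> I \<Longrightarrow> g i differentiable at s"
  shows "arclength_derivative \<gamma> (\<lambda>s. \<Sum>i\<in>I. B (f i s) (g i s)) s
    = (\<Sum>i\<in>I. B (arclength_derivative \<gamma> (f i) s) (g i s) + B (f i s) (arclength_derivative \<gamma> (g i) s))"
proof (rule arclength_derivativeI[OF _ immersion])
  interpret bounded_bilinear B by (rule B)
  have "((\<lambda>s. \<Sum>i\<in>I. B (f i s) (g i s)) has_vector_derivative
    (\<Sum>i\<in>I. B (deriv_fun (f i) s) (g i s) + B (f i s) (deriv_fun (g i) s))) (at s)"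
    by (intro has_vector_derivative_sum has_vector_derivative_bilinear[OF B] assms(3,4))
  then show "((\<lambda>s. \<Sum>i\<in>I. B (f i s) (g i s)) has_vector_derivative norm (deriv_fun \<gamma> s) *\<^sub>R
    (\<Sum>i\<in>I. B (arclength_derivative \<gamma> (f i) s) (g i s) + B (f i s) (arclength_derivative \<gamma> (g i) s))) (at s)"
    using immersion
    by (simp add: arclength_derivative_def scaleR_left scaleR_right scaleR_add_right[symmetric]
        scaleR_sum_right)
qed

locale immersed_curve =
  fixes \<gamma> :: "real \<Rightarrow> real^3"
  assumes smooth: "smooth \<gamma>"
    and immersion: "deriv_fun \<gamma> s \<noteq> 0"
begin

abbreviation y :: "real \<Rightarrow> nat \<Rightarrow> real^3" where
  "y s k \<equiv> Y k \<gamma> s"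

abbreviation y' :: "real \<Rightarrow> nat \<Rightarrow> real^3" where
  "y' s k \<equiv> arclength_derivative \<gamma> (Y k \<gamma>) s"

lemma differentiable_Y: "Y k \<gamma> differentiable at s"
  by (intro smooth_differentiable smooth_Y smooth immersion)

lemma unit_tangent_unit: "unit_tangent \<gamma> s \<bullet> unit_tangent \<gamma> s = 1"
  using immersion[of s] by (simp add: unit_tangent_def arclength_derivative_def dot_square_norm power2_eq_square)

text \<open>The generating series \<open>\<Sum>\<^sub>k Y\<^sub>k x\<^sup>k\<close> has length one: the coefficient of \<open>T\<close> in the recursion is
chosen to achieve just this.\<close>

lemma sum_inner_Y_Suc: "(\<Sum>i = 0..Suc k. y s i \<bullet> y s (Suc k - i)) = 0"
proof -
  have "y s 0 \<bullet> y s (Suc k) = - (1/2) * (\<Sum>i = 1..k. y s i \<bullet> y s (k - i + 1))"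
    unfolding Y.simps(2) using unit_tangent_unit by (simp add: inner_diff_right dot_cross_self)
  moreover have "(\<Sum>i = 1..k. y s i \<bullet> y s (Suc k - i)) = (\<Sum>i = 1..k. y s i \<bullet> y s (k - i + 1))"
    by (intro sum.cong) (auto simp: Suc_diff_le)
  moreover have "(\<Sum>i = 0..Suc k. y s i \<bullet> y s (Suc k - i))
    = y s 0 \<bullet> y s (Suc k) + (\<Sum>i = 1..k. y s i \<bullet> y s (Suc k - i)) + y s (Suc k) \<bullet> y s 0"
    by (simp add: sum.atLeast_Suc_atMost)
  ultimately show ?thesis by (simp add: inner_commute)
qed

lemma sum_inner_derivative: "(\<Sum>i = 0..n. y' s i \<bullet> y s (n - i)) = 0"
proof -
  have "(\<lambda>s. \<Sum>i = 0..n. y s i \<bullet> y s (n - i)) = (\<lambda>s. if n = 0 then 1 else 0)"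
    using unit_tangent_unit sum_inner_Y_Suc by (cases n) (auto simp del: sum.cl_ivl_Suc)
  then have "0 = arclength_derivative \<gamma> (\<lambda>s. \<Sum>i = 0..n. y s i \<bullet> y s (n - i)) s"
    by (simp add: arclength_derivative_def)
  also have "\<dots> = (\<Sum>i = 0..n. y' s i \<bullet> y s (n - i) + y s i \<bullet> y' s (n - i))"
    by (intro arclength_derivative_sum_bilinear bounded_bilinear_inner immersion differentiable_Y)
  also have "\<dots> = (\<Sum>i = 0..n. y' s i \<bullet> y s (n - i)) + (\<Sum>i = 0..n. y s i \<bullet> y' s (n - i))"
    by (rule sum.distrib)
  also have "(\<Sum>i = 0..n. y s i \<bullet> y' s (n - i)) = (\<Sum>i = 0..n. y' s i \<bullet> y s (n - i))"
    by (subst sum.atLeastAtMost_rev) (auto intro!: sum.cong simp: inner_commute)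
  finally show ?thesis by simp
qed

text \<open>By definition \<open>T \<times> Y\<^sub>k\<^sub>+\<^sub>1 = T \<times> (T \<times> Y\<^sub>k')\<close>, which is \<open>- Y\<^sub>k'\<close> as soon as \<open>T \<bullet> Y\<^sub>k' = 0\<close>.
To see this orthogonality, differentiate the coefficient of \<open>x\<^sup>k\<close> in \<open>Y \<bullet> Y = 1\<close>: with the recursion
for smaller indices all terms except \<open>T \<bullet> Y\<^sub>k'\<close> form an antisymmetric sum.\<close>

lemma Y_recursion: "y' s k = - (unit_tangent \<gamma> s \<times> y s (Suc k))"
proof (induction k rule: less_induct)
  case (less n)
  let ?T = "unit_tangent \<gamma> s"
  have "0 = (\<Sum>i = 0..<n. y' s i \<bullet> y s (n - i)) + y' s n \<bullet> ?T"
    using sum_inner_derivative[of s n] by (simp add: sum.last_plus atLeastLessThanSuc_atLeastAtMost[symmetric])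
  also have "(\<Sum>i = 0..<n. y' s i \<bullet> y s (n - i)) = - (\<Sum>i = 0..<n. (?T \<times> y s (Suc i)) \<bullet> y s (n - i))"
    using less by (simp add: sum_negf)
  also have "(\<Sum>i = 0..<n. (?T \<times> y s (Suc i)) \<bullet> y s (n - i)) = (\<Sum>i = 1..n. (?T \<times> y s i) \<bullet> y s (1 + n - i))"
    by (rule sum.reindex_bij_witness[where i = "\<lambda>i. i - 1" and j = Suc]) auto
  also have "\<dots> = 0"
    using sum_skew_eq_0[of "\<lambda>i j. (?T \<times> y s i) \<bullet> y s j" 0 1 n, OF triple_skew] by simp
  finally have "?T \<bullet> y' s n = 0" by (simp add: inner_commute)
  then show ?case
    unfolding Y.simps(2) using unit_tangent_unit[of s]
    by (simp add: Lagrange Cross3.right_diff_distrib cross_mult_right)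
qed

text \<open>The direction \<open>Y\<^sub>k\<close> preserves arclength.\<close>

lemma unit_tangent_orthogonal_derivative: "unit_tangent \<gamma> s \<bullet> y' s k = 0"
  by (simp add: Y_recursion dot_cross_self)

text \<open>The derivative of \<open>Y\<^sub>k\<close> in direction \<open>Y\<^sub>l\<close>, by lemma \<open>variation_Y\<close> below.\<close>

abbreviation \<delta> :: "nat \<Rightarrow> nat \<Rightarrow> real \<Rightarrow> real^3" where
  "\<delta> l k \<equiv> (\<lambda>s. bracket_sum (y s) l k)"

lemma arclength_derivative_delta:
  "arclength_derivative \<gamma> (\<delta> l k) s
    = - (\<delta> l 0 s \<times> y s (Suc k)) - unit_tangent \<gamma> s \<times> \<delta> l (Suc k) s"
  using bracket_sum_derivative[where y = "y s" and y' = "y' s" and l = l and k = k] Y_recursion[where s = s]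
  by (simp add: bracket_sum_def[abs_def]
      arclength_derivative_sum_bilinear[OF bounded_bilinear_cross3 immersion differentiable_Y differentiable_Y])

text \<open>In the arclength preserving direction \<open>Y\<^sub>l\<close>, variation commutes with the arclength derivative. Hence
\<open>T\<close> varies by \<open>Y\<^sub>l' = Y\<^sub>l\<^sub>+\<^sub>1 \<times> T\<close>, and the variations of the other fields are determined by the
linearised recursion, which \<open>\<delta> l\<close> solves.\<close>

lemma variation_Y:
  "smooth_variation (\<lambda>t. Y k (\<lambda>u. \<gamma> u + t *\<^sub>R Y l \<gamma> u)) (\<delta> l k)"
proof (induction k rule: less_induct)
  case (less k)
  define G where "G = (\<lambda>t u. \<gamma> u + t *\<^sub>R Y l \<gamma> u)"
  have G0: "G 0 = \<gamma>" by (simp add: G_def)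
  have G: "smooth_variation G (Y l \<gamma>)"
    unfolding G_def smooth_variation_def
    by (intro allI variation_upto_affine smooth smooth_Y immersion)
  have immersion': "deriv_fun (G 0) s \<noteq> 0" for s
    using immersion by (simp add: G0)
  show ?case
  proof (cases k)
    case 0
    have "smooth_variation (\<lambda>t. arclength_derivative (G t) (G t)) (\<delta> l 0)"
      using smooth_variation_arclength_derivative[OF G immersion' G]
      by (simp add: G0 unit_tangent_orthogonal_derivative Y_recursion bracket_sum_def[abs_def] dot_cross_self
          cross_skew[of "Y (Suc l) \<gamma> _"])
    then show ?thesis
      by (simp add: 0 unit_tangent_def[abs_def] G_def)
  next
    case (Suc m)
    have lower: "smooth_variation (\<lambda>t. Y i (G t)) (\<delta> l i)" if "i \<le> m" for i
      using less[of i] that Suc by (simp add: G_def)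
    have recursion: "\<delta> l 0 s \<times> y' s m
        + unit_tangent \<gamma> s \<times> (arclength_derivative \<gamma> (\<delta> l m) s - (unit_tangent \<gamma> s \<bullet> y' s l) *\<^sub>R y' s m)
        - (((1/2) *\<^sub>R (\<Sum>i = 1..m. \<delta> l i s \<bullet> y s (m - i + 1) + y s i \<bullet> \<delta> l (m - i + 1) s)) *\<^sub>R unit_tangent \<gamma> s
          + ((1/2) *\<^sub>R (\<Sum>i = 1..m. y s i \<bullet> y s (m - i + 1))) *\<^sub>R \<delta> l 0 s)
      = \<delta> l (Suc m) s" for s
    proof -
      let ?T = "unit_tangent \<gamma> s"
      have shift: "(\<Sum>i = 1..m. f i (m - i + 1)) = (\<Sum>i = 1..m. f i (Suc m - i))"
        for f :: "nat \<Rightarrow> nat \<Rightarrow> real"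
        by (intro sum.cong) (auto simp: Suc_diff_le)
      have split: "(\<Sum>i = 0..Suc m. f i) = f 0 + (\<Sum>i = 1..m. f i) + f (Suc m)" for f :: "nat \<Rightarrow> real"
        by (simp add: sum.atLeast_Suc_atMost)
      have "(\<Sum>i = 1..m. y s i \<bullet> y s (m - i + 1)) = - 2 * (?T \<bullet> y s (Suc m))"
        using sum_inner_Y_Suc[of s m] split[of "\<lambda>i. y s i \<bullet> y s (Suc m - i)"]
          shift[of "\<lambda>i j. y s i \<bullet> y s j"]
        by (simp add: inner_commute del: sum.cl_ivl_Suc)
      moreover have half: "(\<Sum>i = 1..m. \<delta> l i s \<bullet> y s (Suc m - i)) = - (\<delta> l 0 s \<bullet> y s (Suc m) + \<delta> l (Suc m) s \<bullet> ?T)"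
        using bracket_sum_inner[of "y s" l "Suc m"] split[of "\<lambda>i. \<delta> l i s \<bullet> y s (Suc m - i)"]
        by (simp del: sum.cl_ivl_Suc)
      moreover have "(\<Sum>i = 1..m. y s i \<bullet> \<delta> l (Suc m - i) s) = (\<Sum>i = 1..m. \<delta> l i s \<bullet> y s (Suc m - i))"
        by (subst sum.atLeastAtMost_rev) (auto intro!: sum.cong simp: inner_commute)
      ultimately have sums:
          "(1/2) *\<^sub>R (\<Sum>i = 1..m. \<delta> l i s \<bullet> y s (m - i + 1) + y s i \<bullet> \<delta> l (m - i + 1) s)
            = - (\<delta> l 0 s \<bullet> y s (Suc m) + \<delta> l (Suc m) s \<bullet> ?T)"
          "(1/2) *\<^sub>R (\<Sum>i = 1..m. y s i \<bullet> y s (m - i + 1)) = - (?T \<bullet> y s (Suc m))"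
        using shift[of "\<lambda>i j. \<delta> l i s \<bullet> y s j + y s i \<bullet> \<delta> l j s"] by (simp_all add: sum.distrib)
      have "?T \<bullet> \<delta> l 0 s = 0"
        by (simp add: bracket_sum_def dot_cross_self)
      from linearised_recursion_solution[OF unit_tangent_unit this, of "y s (Suc m)" "\<delta> l (Suc m) s"]
      show ?thesis
        unfolding sums unit_tangent_orthogonal_derivative scaleR_minus_left
          minus_add_distrib[symmetric] diff_minus_eq_add
        by (simp add: arclength_derivative_delta Y_recursion)
    qed
    have "smooth_variation (\<lambda>t. Y (Suc m) (G t)) (\<delta> l (Suc m))"
      using smooth_variation_Y_Suc[where k = m and Z = "\<delta> l", OF G immersion' lower]
      unfolding G0 recursion .
    then show ?thesis
      by (simp add: Suc G_def)
  qed
qed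

end

section \<open>Equivariance under the monodromy\<close>

text \<open>A diffeomorphism reversing the orientation of the line has a fixed point \<open>c\<close>. The covering \<open>\<pi>\<close> is
invariant under \<open>\<tau>\<close> and immersed at \<open>c\<close>, so that \<open>\<tau>' c = 1\<close>, contrary to \<open>\<tau>\<close> being
decreasing. The sign matters: reversing the orientation would change the sign of \<open>T\<close>.\<close>

lemma translation_deriv_pos:
  assumes "translation \<tau>"
  shows "deriv_fun \<tau> s > 0"
proof -
  from assms have bij: "bij \<tau>" and smooth: "smooth \<tau>" "smooth (inv \<tau>)"
    by (auto simp: translation_def diffeomorphism_def)
  from assms obtain \<pi> :: "real \<Rightarrow> complex" where \<pi>: "smooth \<pi>" "\<And>s. deriv_fun \<pi> s \<noteq> 0"
    "\<And>s t. \<pi> s = \<pi> t \<longleftrightarrow> (\<exists>n. t = (\<tau> ^^ n) s \<or> s = (\<tau> ^^ n) t)"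
    unfolding translation_def by blast
  have d\<tau>: "(\<tau> has_vector_derivative deriv_fun \<tau> s) (at s)" for s
    using smooth_differentiable[OF smooth(1)] by (simp add: vector_derivative_works)
  have cont: "continuous_on S \<tau>" "continuous_on S (deriv_fun \<tau>)" for S
    using smooth_continuous smooth(1) smooth_deriv_fun by (blast intro: continuous_at_imp_continuous_on)+
  have nz: "deriv_fun \<tau> s \<noteq> 0" for s
  proof
    assume 0: "deriv_fun \<tau> s = 0"
    have "(inv \<tau> has_vector_derivative deriv_fun (inv \<tau>) (\<tau> s)) (at (\<tau> s))"
      using smooth_differentiable[OF smooth(2)] by (simp add: vector_derivative_works)
    from vector_diff_chain_at[OF d\<tau> this]
    have "((\<lambda>s. s) has_vector_derivative 0) (at s)"
      using 0 bij by (simp add: o_def bij_is_inj)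
    moreover have "((\<lambda>s. s) has_vector_derivative 1) (at s)"
      by (rule has_vector_derivative_id)
    ultimately have "(0::real) = 1" by (rule vector_derivative_unique_at)
    then show False by simp
  qed
  show ?thesis
  proof (rule ccontr)
    assume "\<not> ?thesis"
    then have neg: "deriv_fun \<tau> s < 0" using nz[of s] by simp
    have all_neg: "deriv_fun \<tau> u < 0" for u
    proof (rule ccontr)
      assume "\<not> deriv_fun \<tau> u < 0"
      moreover have "connected (deriv_fun \<tau> ` UNIV)"
        by (rule connected_continuous_image[OF cont(2) connected_UNIV])
      ultimately have "0 \<in> deriv_fun \<tau> ` UNIV"
        using neg connectedD_interval[of "deriv_fun \<tau> ` UNIV" "deriv_fun \<tau> s" "deriv_fun \<tau> u" 0] by simp
      then show False using nz by auto
    qed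
    have decreasing: "\<tau> v \<le> \<tau> u" if "u \<le> v" for u v
    proof (rule DERIV_nonpos_imp_nonincreasing[OF that], intro exI conjI)
      fix x
      show "(\<tau> has_real_derivative deriv_fun \<tau> x) (at x)"
        using d\<tau> by (simp add: has_real_derivative_iff_has_vector_derivative)
      show "deriv_fun \<tau> x \<le> 0" using all_neg by (rule less_imp_le)
    qed
    \<comment> \<open>For decreasing \<open>\<tau>\<close> the points \<open>0\<close> and \<open>\<tau> 0\<close> enclose a fixed point.\<close>
    have "\<exists>c. min 0 (\<tau> 0) \<le> c \<and> c \<le> max 0 (\<tau> 0) \<and> c - \<tau> c = 0"
    proof (rule IVT')
      show "min 0 (\<tau> 0) - \<tau> (min 0 (\<tau> 0)) \<le> 0"
        using decreasing[of "min 0 (\<tau> 0)" 0] by simp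
      show "0 \<le> max 0 (\<tau> 0) - \<tau> (max 0 (\<tau> 0))"
        using decreasing[of 0 "max 0 (\<tau> 0)"] by simp
    qed (auto intro!: continuous_intros cont)
    then obtain c where "c - \<tau> c = 0" by blast
    then have c: "\<tau> c = c" by simp
    have "\<pi> (\<tau> s) = \<pi> s" for s
      unfolding \<pi>(3) by (rule exI[of _ 1]) simp
    then have "((\<pi> \<circ> \<tau>) has_vector_derivative deriv_fun \<pi> c) (at c)"
      using smooth_differentiable[OF \<pi>(1)] by (simp add: vector_derivative_works o_def)
    moreover have "((\<pi> \<circ> \<tau>) has_vector_derivative deriv_fun \<tau> c *\<^sub>R deriv_fun \<pi> c) (at c)"
      using vector_diff_chain_at[OF d\<tau>[of c], of \<pi> "deriv_fun \<pi> c"] smooth_differentiable[OF \<pi>(1)]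
      by (simp add: c vector_derivative_works)
    ultimately have "deriv_fun \<pi> c = deriv_fun \<tau> c *\<^sub>R deriv_fun \<pi> c"
      by (rule vector_derivative_unique_at)
    then have "(deriv_fun \<tau> c - 1) *\<^sub>R deriv_fun \<pi> c = 0"
      by (simp add: scaleR_left_diff_distrib)
    then show False using \<pi>(2) all_neg[of c] by simp
  qed
qed

text \<open>Differentiating the equivariance of \<open>f\<close> and of \<open>\<gamma>\<close> produces the same factor \<open>\<tau>' > 0\<close>, which
cancels in the quotient; translation parts such as \<open>a\<close> disappear.\<close>

lemma arclength_derivative_equivariant:
  fixes A :: "real^3^3"
  assumes \<tau>: "translation \<tau>" and A: "rotation_matrix A"
    and \<gamma>: "\<And>s. \<gamma> differentiable at s" "\<And>s. \<gamma> (\<tau> s) = A *v \<gamma> s + a"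
    and f: "\<And>s. f differentiable at s" "\<And>s. f (\<tau> s) = A *v f s + b"
  shows "arclength_derivative \<gamma> f (\<tau> s) = A *v arclength_derivative \<gamma> f s"
proof -
  have deriv: "deriv_fun \<tau> s *\<^sub>R deriv_fun g (\<tau> s) = A *v deriv_fun g s"
    if "\<And>s. g differentiable at s" "\<And>s. g (\<tau> s) = A *v g s + c" for g :: "real \<Rightarrow> real^3" and c
  proof -
    have "\<tau> differentiable at s"
      using \<tau> by (auto simp: translation_def diffeomorphism_def intro: smooth_differentiable)
    then have "((g \<circ> \<tau>) has_vector_derivative deriv_fun \<tau> s *\<^sub>R deriv_fun g (\<tau> s)) (at s)"
      using that(1) by (intro vector_diff_chain_at) (simp_all add: vector_derivative_works)
    moreover have "((g \<circ> \<tau>) has_vector_derivative A *v deriv_fun g s) (at s)"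
      using has_vector_derivative_add[OF bounded_linear.has_vector_derivative[OF
            matrix_vector_mul_bounded_linear that(1)[unfolded vector_derivative_works]]
          has_vector_derivative_const[of c]] that(2) by (simp add: o_def)
    ultimately show ?thesis by (rule vector_derivative_unique_at)
  qed
  have pos: "deriv_fun \<tau> s > 0" using \<tau> by (rule translation_deriv_pos)
  have "norm (A *v deriv_fun \<gamma> s) = norm (deriv_fun \<gamma> s)"
    using A by (simp add: rotation_matrix_def orthogonal_transformation_norm orthogonal_transformation_matrix)
  then have speed: "norm (deriv_fun \<gamma> s) = deriv_fun \<tau> s * norm (deriv_fun \<gamma> (\<tau> s))"
    using deriv[OF \<gamma>] pos by (metis abs_of_pos norm_scaleR)
  have "arclength_derivative \<gamma> f (\<tau> s)
      = (deriv_fun \<tau> s *\<^sub>R deriv_fun f (\<tau> s)) /\<^sub>R (deriv_fun \<tau> s * norm (deriv_fun \<gamma> (\<tau> s)))"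
    using pos by (simp add: arclength_derivative_def)
  also have "\<dots> = A *v arclength_derivative \<gamma> f s"
    unfolding deriv[OF f] speed[symmetric]
    by (simp add: arclength_derivative_def matrix_vector_mult_scaleR)
  finally show ?thesis .
qed

text \<open>All ingredients of the recursion commute with rotations, and the arclength derivative commutes with
orientation preserving reparametrisations.\<close>

lemma Y_equivariant:
  assumes \<tau>: "translation \<tau>" and A: "rotation_matrix A" and \<gamma>: "\<gamma> \<in> curves \<tau> A a"
  shows "Y k \<gamma> (\<tau> s) = A *v Y k \<gamma> s"
proof (induction k arbitrary: s rule: less_induct)
  case (less k)
  interpret immersed_curve \<gamma>
    using \<gamma> by unfold_locales (auto simp: curves_def)
  have \<gamma>': "\<And>s. \<gamma> differentiable at s" "\<And>s. \<gamma> (\<tau> s) = A *v \<gamma> s + a"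
    using \<gamma> by (auto simp: curves_def intro: smooth_differentiable)
  note arclength = arclength_derivative_equivariant[OF \<tau> A \<gamma>']
  have T: "unit_tangent \<gamma> (\<tau> s) = A *v unit_tangent \<gamma> s"
    using arclength[OF \<gamma>'] by (simp add: unit_tangent_def)
  have inner: "(A *v u) \<bullet> (A *v v) = u \<bullet> v" for u v
  proof -
    have "orthogonal_transformation ((*v) A)"
      using A by (simp add: rotation_matrix_def orthogonal_transformation_matrix)
    then show ?thesis by (simp add: orthogonal_transformation_def)
  qed
  show ?case
  proof (cases k)
    case 0
    then show ?thesis using T by simp
  next
    case (Suc m)
    have "arclength_derivative \<gamma> (Y m \<gamma>) (\<tau> s) = A *v arclength_derivative \<gamma> (Y m \<gamma>) s"
      using arclength[OF differentiable_Y, of m 0] less Suc by simp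
    moreover have "(\<Sum>i = 1..m. Y i \<gamma> (\<tau> s) \<bullet> Y (m - i + 1) \<gamma> (\<tau> s))
        = (\<Sum>i = 1..m. Y i \<gamma> s \<bullet> Y (m - i + 1) \<gamma> s)"
      using less Suc by (intro sum.cong) (auto simp: inner)
    ultimately show ?thesis
      unfolding Suc Y.simps(2) T
      by (simp add: cross_rotation_matrix[OF A] matrix_vector_mult_diff_distrib matrix_vector_mult_scaleR)
  qed
qed

section \<open>Commutation of the vector fields\<close>

lemma has_directional_derivative_Y:
  assumes \<tau>: "translation \<tau>" and A: "rotation_matrix A" and \<gamma>: "\<gamma> \<in> curves \<tau> A a"
  shows "has_directional_derivative \<tau> A (Y k) \<gamma> (Y l \<gamma>) (\<lambda>s. bracket_sum (\<lambda>i. Y i \<gamma> s) l k)"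
proof -
  interpret immersed_curve \<gamma>
    using \<gamma> by unfold_locales (auto simp: curves_def)
  have sum_A: "A *v (\<Sum>i\<in>I. f i) = (\<Sum>i\<in>I. A *v f i)" for I and f :: "nat \<Rightarrow> real^3"
    by (rule linear_sum[OF matrix_vector_mul_linear])
  have "bracket_sum (\<lambda>i. Y i \<gamma> (\<tau> s)) l k = A *v bracket_sum (\<lambda>i. Y i \<gamma> s) l k" for s
    by (simp add: bracket_sum_def Y_equivariant[OF assms] cross_rotation_matrix[OF A] sum_A)
  then show ?thesis
    using smooth_variation_smooth(2)[OF variation_Y] smooth_variation_uniform_limit[OF variation_Y]
    by (simp add: has_directional_derivative_def tangent_space_def)
qed

theorem theorem10:
  fixes \<tau> :: "real \<Rightarrow> real" and A :: "real^3^3" and a :: "real^3"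
    and \<gamma> :: "real \<Rightarrow> real^3" and k l :: nat
  assumes "translation \<tau>"
    and "rotation_matrix A"
    and "\<gamma> \<in> curves \<tau> A a"
  shows "has_lie_bracket \<tau> A (Y k) (Y l) \<gamma> (\<lambda>s. 0)"
proof -
  have "has_directional_derivative \<tau> A (Y l) \<gamma> (Y k \<gamma>) (\<lambda>s. bracket_sum (\<lambda>i. Y i \<gamma> s) k l)"
    "has_directional_derivative \<tau> A (Y k) \<gamma> (Y l \<gamma>) (\<lambda>s. bracket_sum (\<lambda>i. Y i \<gamma> s) l k)"
    using has_directional_derivative_Y[OF assms] by blast+
  moreover have "(\<lambda>s. 0) = (\<lambda>s. bracket_sum (\<lambda>i. Y i \<gamma> s) k l - bracket_sum (\<lambda>i. Y i \<gamma> s) l k)"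
    by (simp add: bracket_sum_commute[of _ k l])
  ultimately show ?thesis unfolding has_lie_bracket_def by blast
qed

end
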